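(* Let $A$ be a finite alphabet. For every $k$, $TL[\mathsf U,\mathsf S]^k\le TL[X_\phi,Y_\phi]^k$: for every formula of $TL[\mathsf U,\mathsf S]$ with nesting depth of $\mathsf U,\mathsf S$ at most $k$ there is a formula of $TL[X_\phi,Y_\phi]$ of recursion depth at most $k$ defining the same language of nonempty finite words over $A$. Hence $TL[X_\phi,Y_\phi]\equiv LTL\equiv FO[<]$, i.e. the three logics $TL[X_\phi,Y_\phi]$, $LTL=TL[\mathsf U,\mathsf S]$ and first-order logic $FO[<]$ over words define the same class of languages of nonempty finite words over $A$.
   Context: Words $w\in A^+$ have positions $dom(w)=\{1,\dots,|w|\}$. A temporal formula $\phi$ defines the language $\{w\in A^+ \mid w,1\models\phi\}$; in both temporal logics $w,i\models a$ iff $w[i]=a$, and Boolean operators are as usual. **$LTL=TL[\mathsf U,\mathsf S]$**: formulae built from letters $a\in A$ and $\top$ with Boolean connectives and the (strict) modalities - $w,i\models\phi\,\mathsf U\,\psi$ iff for some $m>i$ in $dom(w)$: $w,m\models\psi$ and $w,l\models\phi$ for all $i<l<m$; - $w,i\models\phi\,\mathsf S\,\psi$ iff for some $m<i$ in $dom(w)$: $w,m\models\psi$ and $w,l\models\phi$ for all $m<l<i$. $TL[\mathsf U,\mathsf S]^k$ denotes the formulae in which the modalities $\mathsf U,\mathsf S$ are nested to depth at most $k$. **$TL[X_\phi,Y_\phi]$** (AtNext logic): $\phi ::= \top \mid a \mid X_\phi\phi \mid Y_\phi\phi \mid \phi\lor\phi \mid \neg\phi$, with - $w,i\models X_\phi\psi$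 iff there is $j>i$ with $w,j\models\phi\land\psi$ and $w,k\not\models\phi$ for all $i<k<j$; - $w,i\models Y_\phi\psi$ iff there is $j<i$ with $w,j\models\phi\land\psi$ and $w,k\not\models\phi$ for all $j<k<i$. Recursion depth: $rd(a)=rd(\top)=0$, $rd(\phi_1\lor\phi_2)=\max(rd(\phi_1),rd(\phi_2))$, $rd(\neg\phi)=rd(\phi)$, $rd(X_\zeta\psi)=rd(Y_\zeta\psi)=\max(rd(\zeta)+1,rd(\psi))$. $TL[X_\phi,Y_\phi]^k$ denotes the formulae of recursion depth at most $k$. **$FO[<]$**: first-order sentences over word positions with the order $<$ and unary letter predicates for $a\in A$. *)

theory Defs
  imports Main
begin

definition dom_word :: "'a list \<Rightarrow> nat set" where
  "dom_word w = {1..length w}"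

text \<open>Positions are 1-based, lists are 0-based; \<open>letter_at w i\<close> is meaningful for
  \<open>i \<in> dom_word w\<close> only, and all languages below evaluate formulas at such positions only.\<close>

definition letter_at :: "'a list \<Rightarrow> nat \<Rightarrow> 'a" where
  "letter_at w i = w ! (i - 1)"

datatype 'a ltl =
    LTop
  | LLetter 'a
  | LNot "'a ltl"
  | LOr "'a ltl" "'a ltl"
  | LAnd "'a ltl" "'a ltl"
  | LUntil "'a ltl" "'a ltl"
  | LSince "'a ltl" "'a ltl"

primrec ltl_sat :: "'a list \<Rightarrow> nat \<Rightarrow> 'a ltl \<Rightarrow> bool" where
  "ltl_sat w i LTop \<longleftrightarrow> True"
| "ltl_sat w i (LLetter a) \<longleftrightarrow> letter_at w i = a"
| "ltl_sat w i (LNot \<phi>) \<longleftrightarrow> \<not> ltl_sat w i \<phi>"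
| "ltl_sat w i (LOr \<phi> \<psi>) \<longleftrightarrow> ltl_sat w i \<phi> \<or> ltl_sat w i \<psi>"
| "ltl_sat w i (LAnd \<phi> \<psi>) \<longleftrightarrow> ltl_sat w i \<phi> \<and> ltl_sat w i \<psi>"
| "ltl_sat w i (LUntil \<phi> \<psi>) \<longleftrightarrow>
     (\<exists>m \<in> dom_word w. m > i \<and> ltl_sat w m \<psi> \<and> (\<forall>l. i < l \<and> l < m \<longrightarrow> ltl_sat w l \<phi>))"
| "ltl_sat w i (LSince \<phi> \<psi>) \<longleftrightarrow>
     (\<exists>m \<in> dom_word w. m < i \<and> ltl_sat w m \<psi> \<and> (\<forall>l. m < l \<and> l < i \<longrightarrow> ltl_sat w l \<phi>))"

primrec ltl_depth :: "'a ltl \<Rightarrow> nat" where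
  "ltl_depth LTop = 0"
| "ltl_depth (LLetter a) = 0"
| "ltl_depth (LNot \<phi>) = ltl_depth \<phi>"
| "ltl_depth (LOr \<phi> \<psi>) = max (ltl_depth \<phi>) (ltl_depth \<psi>)"
| "ltl_depth (LAnd \<phi> \<psi>) = max (ltl_depth \<phi>) (ltl_depth \<psi>)"
| "ltl_depth (LUntil \<phi> \<psi>) = max (ltl_depth \<phi>) (ltl_depth \<psi>) + 1"
| "ltl_depth (LSince \<phi> \<psi>) = max (ltl_depth \<phi>) (ltl_depth \<psi>) + 1"

definition ltl_lang :: "'a ltl \<Rightarrow> 'a list set" where
  "ltl_lang \<phi> = {w. w \<noteq> [] \<and> ltl_sat w 1 \<phi>}"

text \<open>\<open>AtNext \<phi> \<psi>\<close> is \<open>X\<^sub>\<phi> \<psi>\<close> and \<open>AtPrev \<phi> \<psi>\<close> is \<open>Y\<^sub>\<phi> \<psi>\<close>: the first argument is the subscript.\<close>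

datatype 'a atn =
    ATop
  | ALetter 'a
  | AtNext "'a atn" "'a atn"
  | AtPrev "'a atn" "'a atn"
  | AOr "'a atn" "'a atn"
  | ANot "'a atn"

primrec atn_sat :: "'a list \<Rightarrow> nat \<Rightarrow> 'a atn \<Rightarrow> bool" where
  "atn_sat w i ATop \<longleftrightarrow> True"
| "atn_sat w i (ALetter a) \<longleftrightarrow> letter_at w i = a"
| "atn_sat w i (AtNext \<phi> \<psi>) \<longleftrightarrow>
     (\<exists>j \<in> dom_word w. j > i \<and> (atn_sat w j \<phi> \<and> atn_sat w j \<psi>) \<and>
        (\<forall>k. i < k \<and> k < j \<longrightarrow> \<not> atn_sat w k \<phi>))"
| "atn_sat w i (AtPrev \<phi> \<psi>) \<longleftrightarrow>
     (\<exists>j \<in> dom_word w. j < i \<and> (atn_sat w j \<phi> \<and> atn_sat w j \<psi>) \<and>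
        (\<forall>k. j < k \<and> k < i \<longrightarrow> \<not> atn_sat w k \<phi>))"
| "atn_sat w i (AOr \<phi> \<psi>) \<longleftrightarrow> atn_sat w i \<phi> \<or> atn_sat w i \<psi>"
| "atn_sat w i (ANot \<phi>) \<longleftrightarrow> \<not> atn_sat w i \<phi>"

primrec atn_rd :: "'a atn \<Rightarrow> nat" where
  "atn_rd ATop = 0"
| "atn_rd (ALetter a) = 0"
| "atn_rd (AtNext \<zeta> \<psi>) = max (atn_rd \<zeta> + 1) (atn_rd \<psi>)"
| "atn_rd (AtPrev \<zeta> \<psi>) = max (atn_rd \<zeta> + 1) (atn_rd \<psi>)"
| "atn_rd (AOr \<phi> \<psi>) = max (atn_rd \<phi>) (atn_rd \<psi>)"
| "atn_rd (ANot \<phi>) = atn_rd \<phi>"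

definition atn_lang :: "'a atn \<Rightarrow> 'a list set" where
  "atn_lang \<phi> = {w. w \<noteq> [] \<and> atn_sat w 1 \<phi>}"

text \<open>Variables are named by natural numbers and may be reused by nested quantifiers.\<close>

datatype 'a fo =
    FLess nat nat
  | FEq nat nat
  | FLetter 'a nat
  | FNot "'a fo"
  | FOr "'a fo" "'a fo"
  | FAnd "'a fo" "'a fo"
  | FEx nat "'a fo"
  | FAll nat "'a fo"

primrec fo_sat :: "'a list \<Rightarrow> (nat \<Rightarrow> nat) \<Rightarrow> 'a fo \<Rightarrow> bool" where
  "fo_sat w v (FLess x y) \<longleftrightarrow> v x < v y"
| "fo_sat w v (FEq x y) \<longleftrightarrow> v x = v y"
| "fo_sat w v (FLetter a x) \<longleftrightarrow> letter_at w (v x) = a"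
| "fo_sat w v (FNot \<phi>) \<longleftrightarrow> \<not> fo_sat w v \<phi>"
| "fo_sat w v (FOr \<phi> \<psi>) \<longleftrightarrow> fo_sat w v \<phi> \<or> fo_sat w v \<psi>"
| "fo_sat w v (FAnd \<phi> \<psi>) \<longleftrightarrow> fo_sat w v \<phi> \<and> fo_sat w v \<psi>"
| "fo_sat w v (FEx x \<phi>) \<longleftrightarrow> (\<exists>i \<in> dom_word w. fo_sat w (v(x := i)) \<phi>)"
| "fo_sat w v (FAll x \<phi>) \<longleftrightarrow> (\<forall>i \<in> dom_word w. fo_sat w (v(x := i)) \<phi>)"

primrec fo_free :: "'a fo \<Rightarrow> nat set" where
  "fo_free (FLess x y) = {x, y}"
| "fo_free (FEq x y) = {x, y}"
| "fo_free (FLetter a x) = {x}"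
| "fo_free (FNot \<phi>) = fo_free \<phi>"
| "fo_free (FOr \<phi> \<psi>) = fo_free \<phi> \<union> fo_free \<psi>"
| "fo_free (FAnd \<phi> \<psi>) = fo_free \<phi> \<union> fo_free \<psi>"
| "fo_free (FEx x \<phi>) = fo_free \<phi> - {x}"
| "fo_free (FAll x \<phi>) = fo_free \<phi> - {x}"

definition fo_sentence :: "'a fo \<Rightarrow> bool" where
  "fo_sentence \<phi> \<longleftrightarrow> fo_free \<phi> = {}"

text \<open>For sentences the choice of the initial assignment is immaterial.\<close>

definition fo_lang :: "'a fo \<Rightarrow> 'a list set" where
  "fo_lang \<phi> = {w. w \<noteq> [] \<and> fo_sat w (\<lambda>_. 1) \<phi>}"

definition ltl_definable :: "'a list set set" where
  "ltl_definable = {ltl_lang \<phi> | \<phi>. True}"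

definition atn_definable :: "'a list set set" where
  "atn_definable = {atn_lang \<phi> | \<phi>. True}"

definition fo_definable :: "'a list set set" where
  "fo_definable = {fo_lang \<phi> | \<phi>. fo_sentence \<phi>}"

end

theory Submission
  imports Defs "HOL-Algebra.Group"
begin

text \<open>
  A formula \<open>\<phi> U \<psi>\<close> holds iff the next position satisfying \<open>\<not> \<phi> \<or> \<psi>\<close> satisfies
  \<open>\<psi>\<close>, so it is \<open>X\<close> with subscript \<open>\<not> \<phi> \<or> \<psi>\<close> applied to \<open>\<psi>\<close>; conversely
  \<open>X\<close> with subscript \<open>\<phi>\<close> applied to \<open>\<psi>\<close> is \<open>(\<not> \<phi>) U (\<phi> \<and> \<psi>)\<close>.

  For first-order logic to LTL, the words modulo a back-and-forth equivalence form a finite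
  aperiodic monoid through which every sentence of bounded quantifier rank factors. The value of a
  word in a finite aperiodic monoid is expressible in LTL by the local divisor induction of Diekert
  and Gastin: choose a label \<open>c\<close> other than the unit and cut the word at the positions labelled
  \<open>c\<close>. The blocks in between use fewer labels, and the sequence of blocks is evaluated in the local
  divisor of the monoid at \<open>c\<close>, which is smaller. No change of alphabet is needed since
  the induction is about LTL-expressible labellings of the positions of a fixed word.
\<close>

section \<open>Until and AtNext\<close>

primrec ltl_to_atn :: "'a ltl \<Rightarrow> 'a atn" where
  "ltl_to_atn LTop = ATop"
| "ltl_to_atn (LLetter a) = ALetter a"
| "ltl_to_atn (LNot \<phi>) = ANot (ltl_to_atn \<phi>)"
| "ltl_to_atn (LOr \<phi> \<psi>) = AOr (ltl_to_atn \<phi>) (ltl_to_atn \<psi>)"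
| "ltl_to_atn (LAnd \<phi> \<psi>) = ANot (AOr (ANot (ltl_to_atn \<phi>)) (ANot (ltl_to_atn \<psi>)))"
| "ltl_to_atn (LUntil \<phi> \<psi>) = AtNext (AOr (ANot (ltl_to_atn \<phi>)) (ltl_to_atn \<psi>)) (ltl_to_atn \<psi>)"
| "ltl_to_atn (LSince \<phi> \<psi>) = AtPrev (AOr (ANot (ltl_to_atn \<phi>)) (ltl_to_atn \<psi>)) (ltl_to_atn \<psi>)"

lemma atn_rd_ltl_to_atn: "atn_rd (ltl_to_atn \<phi>) = ltl_depth \<phi>"
  by (induction \<phi>) auto

text \<open>Choose the least witness \<open>m\<close>: a position before it satisfying
  \<open>Q\<close> would be a smaller witness, so \<open>Q\<close> fails there while
  \<open>P\<close> holds. The set \<open>D\<close> stands for the positions of the word; closure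
  under intermediate positions puts the smaller witness into \<open>D\<close>.\<close>

lemma until_iff_first_occurrence:
  fixes P Q :: "nat \<Rightarrow> bool"
  assumes D: "\<And>m l. m \<in> D \<Longrightarrow> i < l \<Longrightarrow> l < m \<Longrightarrow> l \<in> D"
  shows "(\<exists>m\<in>D. i < m \<and> Q m \<and> (\<forall>l. i < l \<and> l < m \<longrightarrow> P l)) \<longleftrightarrow>
    (\<exists>m\<in>D. i < m \<and> ((\<not> P m \<or> Q m) \<and> Q m) \<and> (\<forall>l. i < l \<and> l < m \<longrightarrow> \<not> (\<not> P l \<or> Q l)))"
proof
  assume "\<exists>m\<in>D. i < m \<and> Q m \<and> (\<forall>l. i < l \<and> l < m \<longrightarrow> P l)"
  then have ex: "\<exists>m. m \<in> D \<and> i < m \<and> Q m \<and> (\<forall>l. i < l \<and> l < m \<longrightarrow> P l)" by blast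
  define m where "m = (LEAST m. m \<in> D \<and> i < m \<and> Q m \<and> (\<forall>l. i < l \<and> l < m \<longrightarrow> P l))"
  have m: "m \<in> D" "i < m" "Q m" "\<forall>l. i < l \<and> l < m \<longrightarrow> P l"
    using LeastI_ex[OF ex] unfolding m_def by auto
  have "\<not> Q l" if "i < l" "l < m" for l
    using not_less_Least[OF that(2)[unfolded m_def]] m that D by auto
  with m show "\<exists>m\<in>D. i < m \<and> ((\<not> P m \<or> Q m) \<and> Q m) \<and> (\<forall>l. i < l \<and> l < m \<longrightarrow> \<not> (\<not> P l \<or> Q l))"
    by blast
qed blast

lemma since_iff_last_occurrence:
  fixes P Q :: "nat \<Rightarrow> bool"
  assumes D: "\<And>m l. m \<in> D \<Longrightarrow> m < l \<Longrightarrow> l < i \<Longrightarrow> l \<in> D"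
  shows "(\<exists>m\<in>D. m < i \<and> Q m \<and> (\<forall>l. m < l \<and> l < i \<longrightarrow> P l)) \<longleftrightarrow>
    (\<exists>m\<in>D. m < i \<and> ((\<not> P m \<or> Q m) \<and> Q m) \<and> (\<forall>l. m < l \<and> l < i \<longrightarrow> \<not> (\<not> P l \<or> Q l)))"
proof
  let ?R = "\<lambda>m. m \<in> D \<and> m < i \<and> Q m \<and> (\<forall>l. m < l \<and> l < i \<longrightarrow> P l)"
  assume "\<exists>m\<in>D. m < i \<and> Q m \<and> (\<forall>l. m < l \<and> l < i \<longrightarrow> P l)"
  then have ex: "\<exists>m. ?R m" by blast
  \<comment> \<open>On the naturals \<open>GREATEST\<close> is meaningful only for a bounded
    property; \<open>i\<close> is the bound.\<close>
  have bound: "\<forall>m. ?R m \<longrightarrow> m \<le> i" by auto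
  define m where "m = (GREATEST m. ?R m)"
  have m: "?R m"
    using GreatestI_ex_nat[of ?R, OF ex] bound unfolding m_def by blast
  have "\<not> Q l" if "m < l" "l < i" for l
  proof
    assume "Q l"
    then have "?R l" using m that D by auto
    then have "l \<le> m" unfolding m_def using Greatest_le_nat[of ?R l i] bound by blast
    then show False using that by simp
  qed
  with m show "\<exists>m\<in>D. m < i \<and> ((\<not> P m \<or> Q m) \<and> Q m) \<and> (\<forall>l. m < l \<and> l < i \<longrightarrow> \<not> (\<not> P l \<or> Q l))"
    by blast
qed blast

text \<open>The two occurrence lemmas carry the modal cases. Restricting \<open>i\<close> to the
  word keeps every position looked at in \<open>dom_word w\<close>, also those between a past
  witness and \<open>i\<close>.\<close>

lemma atn_sat_ltl_to_atn:
  "i \<in> dom_word w \<Longrightarrow> atn_sat w i (ltl_to_atn \<phi>) \<longleftrightarrow> ltl_sat w i \<phi>"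
proof (induction \<phi> arbitrary: i)
  case (LUntil \<phi> \<psi>)
  let ?P = "\<lambda>i. atn_sat w i (ltl_to_atn \<phi>)" and ?Q = "\<lambda>i. atn_sat w i (ltl_to_atn \<psi>)"
  have "ltl_sat w i (LUntil \<phi> \<psi>) \<longleftrightarrow>
      (\<exists>m\<in>dom_word w. i < m \<and> ?Q m \<and> (\<forall>l. i < l \<and> l < m \<longrightarrow> ?P l))"
    using LUntil by (fastforce simp: dom_word_def)
  then show ?case
    using until_iff_first_occurrence[of "dom_word w" i ?Q ?P] by (auto simp: dom_word_def)
next
  case (LSince \<phi> \<psi>)
  let ?P = "\<lambda>i. atn_sat w i (ltl_to_atn \<phi>)" and ?Q = "\<lambda>i. atn_sat w i (ltl_to_atn \<psi>)"
  have "ltl_sat w i (LSince \<phi> \<psi>) \<longleftrightarrow>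
      (\<exists>m\<in>dom_word w. m < i \<and> ?Q m \<and> (\<forall>l. m < l \<and> l < i \<longrightarrow> ?P l))"
    using LSince by (fastforce simp: dom_word_def)
  then show ?case
    using since_iff_last_occurrence[of "dom_word w" i ?Q ?P] LSince.prems by (auto simp: dom_word_def)
qed auto

section \<open>From AtNext logic back to LTL\<close>

primrec atn_to_ltl :: "'a atn \<Rightarrow> 'a ltl" where
  "atn_to_ltl ATop = LTop"
| "atn_to_ltl (ALetter a) = LLetter a"
| "atn_to_ltl (AtNext \<phi> \<psi>) =
     LUntil (LNot (atn_to_ltl \<phi>)) (LAnd (atn_to_ltl \<phi>) (atn_to_ltl \<psi>))"
| "atn_to_ltl (AtPrev \<phi> \<psi>) =
     LSince (LNot (atn_to_ltl \<phi>)) (LAnd (atn_to_ltl \<phi>) (atn_to_ltl \<psi>))"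
| "atn_to_ltl (AOr \<phi> \<psi>) = LOr (atn_to_ltl \<phi>) (atn_to_ltl \<psi>)"
| "atn_to_ltl (ANot \<phi>) = LNot (atn_to_ltl \<phi>)"

lemma ltl_sat_atn_to_ltl: "ltl_sat w i (atn_to_ltl \<phi>) \<longleftrightarrow> atn_sat w i \<phi>"
  by (induction \<phi> arbitrary: i) auto

lemma one_in_dom_word: "w \<noteq> [] \<Longrightarrow> 1 \<in> dom_word w"
  by (cases w) (auto simp: dom_word_def)

lemma atn_lang_ltl_to_atn: "atn_lang (ltl_to_atn \<phi>) = ltl_lang \<phi>"
  unfolding atn_lang_def ltl_lang_def using atn_sat_ltl_to_atn one_in_dom_word by blast

lemma ltl_lang_atn_to_ltl: "ltl_lang (atn_to_ltl \<phi>) = atn_lang \<phi>"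
  unfolding atn_lang_def ltl_lang_def by (simp add: ltl_sat_atn_to_ltl)

section \<open>From temporal logic to first-order logic\<close>

text \<open>The second argument names the variable of the current position. All bound variables are
  larger than it and each translated subformula has only its own variable free, so reusing names in
  nested quantifiers captures nothing.\<close>

primrec ltl_to_fo :: "'a ltl \<Rightarrow> nat \<Rightarrow> 'a fo" where
  "ltl_to_fo LTop x = FEq x x"
| "ltl_to_fo (LLetter a) x = FLetter a x"
| "ltl_to_fo (LNot \<phi>) x = FNot (ltl_to_fo \<phi> x)"
| "ltl_to_fo (LOr \<phi> \<psi>) x = FOr (ltl_to_fo \<phi> x) (ltl_to_fo \<psi> x)"
| "ltl_to_fo (LAnd \<phi> \<psi>) x = FAnd (ltl_to_fo \<phi> x) (ltl_to_fo \<psi> x)"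
| "ltl_to_fo (LUntil \<phi> \<psi>) x =
     FEx (x + 1) (FAnd (FLess x (x + 1)) (FAnd (ltl_to_fo \<psi> (x + 1))
       (FAll (x + 2) (FOr (FNot (FAnd (FLess x (x + 2)) (FLess (x + 2) (x + 1))))
          (ltl_to_fo \<phi> (x + 2))))))"
| "ltl_to_fo (LSince \<phi> \<psi>) x =
     FEx (x + 1) (FAnd (FLess (x + 1) x) (FAnd (ltl_to_fo \<psi> (x + 1))
       (FAll (x + 2) (FOr (FNot (FAnd (FLess (x + 1) (x + 2)) (FLess (x + 2) x)))
          (ltl_to_fo \<phi> (x + 2))))))"

lemma fo_free_ltl_to_fo: "fo_free (ltl_to_fo \<phi> x) \<subseteq> {x}"
proof (induction \<phi> arbitrary: x)
  case (LUntil \<phi> \<psi>)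
  from LUntil(1)[of "x + 2"] LUntil(2)[of "x + 1"] show ?case by auto
next
  case (LSince \<phi> \<psi>)
  from LSince(1)[of "x + 2"] LSince(2)[of "x + 1"] show ?case by auto
qed (simp_all, (blast+)?)

lemma fo_sat_ltl_to_fo:
  "v x \<in> dom_word w \<Longrightarrow> fo_sat w v (ltl_to_fo \<phi> x) \<longleftrightarrow> ltl_sat w (v x) \<phi>"
proof (induction \<phi> arbitrary: v x)
  case (LUntil \<phi> \<psi>)
  have \<phi>: "fo_sat w (v(Suc x := m, Suc (Suc x) := l)) (ltl_to_fo \<phi> (Suc (Suc x))) = ltl_sat w l \<phi>"
    if "l \<in> dom_word w" for l m
    using that by (subst LUntil.IH(1)) simp_all
  have \<psi>: "fo_sat w (v(Suc x := m)) (ltl_to_fo \<psi> (Suc x)) = ltl_sat w m \<psi>"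
    if "m \<in> dom_word w" for m
    using that by (subst LUntil.IH(2)) simp_all
  have "l \<in> dom_word w" if "m \<in> dom_word w" "v x < l" "l < m" for l m
    using that by (simp add: dom_word_def)
  then show ?case by (simp add: \<phi> \<psi> cong: bex_cong ball_cong) blast
next
  case (LSince \<phi> \<psi>)
  have \<phi>: "fo_sat w (v(Suc x := m, Suc (Suc x) := l)) (ltl_to_fo \<phi> (Suc (Suc x))) = ltl_sat w l \<phi>"
    if "l \<in> dom_word w" for l m
    using that by (subst LSince.IH(1)) simp_all
  have \<psi>: "fo_sat w (v(Suc x := m)) (ltl_to_fo \<psi> (Suc x)) = ltl_sat w m \<psi>"
    if "m \<in> dom_word w" for m
    using that by (subst LSince.IH(2)) simp_all
  have "l \<in> dom_word w" if "m < l" "l < v x" for l m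
    using that LSince.prems by (simp add: dom_word_def)
  then show ?case by (simp add: \<phi> \<psi> cong: bex_cong ball_cong) blast
qed auto

lemma ltl_lang_in_fo_definable: "ltl_lang \<phi> \<in> fo_definable"
proof -
  \<comment> \<open>A sentence has no name for position 1, so it is described as the position with
    no smaller one.\<close>
  define \<theta> where "\<theta> = FEx 0 (FAnd (FNot (FEx 1 (FLess 1 0))) (ltl_to_fo \<phi> 0))"
  have "fo_sentence \<theta>"
    using fo_free_ltl_to_fo[of \<phi> 0] by (auto simp: \<theta>_def fo_sentence_def)
  moreover have "fo_lang \<theta> = ltl_lang \<phi>"
  proof -
    have "fo_sat w (\<lambda>_. 1) \<theta> \<longleftrightarrow> ltl_sat w 1 \<phi>" if w: "w \<noteq> []" for w
    proof -
      have "i = 1 \<longleftrightarrow> \<not> (\<exists>j\<in>dom_word w. j < i)" if i: "i \<in> dom_word w" for i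
        using i one_in_dom_word[OF w] unfolding dom_word_def
        by (metis atLeastAtMost_iff le_antisym not_le)
      then show ?thesis
        using one_in_dom_word[OF w] fo_sat_ltl_to_fo[of _ 0 w \<phi>]
        by (auto simp: \<theta>_def)
    qed
    then show ?thesis unfolding fo_lang_def ltl_lang_def by blast
  qed
  ultimately show ?thesis unfolding fo_definable_def by blast
qed

section \<open>Ehrenfeucht-Fraisse equivalence of words\<close>

text \<open>One direction of a round of the Ehrenfeucht-Fraisse game. Choosing a position cuts the
  word into a left factor, a letter and a right factor; the answer must have the same letter, and
  the game goes on in the two factors separately.\<close>

definition ef_step :: "('a list \<Rightarrow> 'a list \<Rightarrow> bool) \<Rightarrow> 'a list \<Rightarrow> 'a list \<Rightarrow> bool" where
  "ef_step R u v \<longleftrightarrow>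
     (\<forall>x a y. u = x @ a # y \<longrightarrow> (\<exists>x' y'. v = x' @ a # y' \<and> R x x' \<and> R y y'))"

primrec ef_equiv :: "nat \<Rightarrow> 'a list \<Rightarrow> 'a list \<Rightarrow> bool" where
  "ef_equiv 0 = (\<lambda>u v. True)"
| "ef_equiv (Suc k) = (\<lambda>u v. ef_step (ef_equiv k) u v \<and> ef_step (ef_equiv k) v u)"

lemma ef_stepD:
  assumes "ef_step R u v" "u = x @ a # y"
  obtains x' y' where "v = x' @ a # y'" "R x x'" "R y y'"
  using assms unfolding ef_step_def by blast

lemma ef_equiv_SucE:
  assumes "ef_equiv (Suc k) u v" "u = x @ a # y"
  obtains x' y' where "v = x' @ a # y'" "ef_equiv k x x'" "ef_equiv k y y'"
  using assms by (metis ef_equiv.simps(2) ef_stepD)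

lemma ef_equiv_refl: "ef_equiv k u u"
  by (induction k arbitrary: u) (auto simp: ef_step_def)

lemma ef_equiv_sym: "ef_equiv k u v \<Longrightarrow> ef_equiv k v u"
  by (cases k) auto

lemma ef_step_mono:
  assumes "ef_step R u v" "\<And>x y. R x y \<Longrightarrow> S x y"
  shows "ef_step S u v"
  unfolding ef_step_def
proof (intro allI impI)
  fix x a y assume "u = x @ a # y"
  from ef_stepD[OF assms(1) this] obtain x' y' where "v = x' @ a # y'" "R x x'" "R y y'" .
  with assms(2) show "\<exists>x' y'. v = x' @ a # y' \<and> S x x' \<and> S y y'" by blast
qed

lemma ef_step_trans:
  assumes "ef_step R u v" "ef_step R v w" "\<And>x y z. R x y \<Longrightarrow> R y z \<Longrightarrow> R x z"
  shows "ef_step R u w"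
  unfolding ef_step_def
proof (intro allI impI)
  fix x a y assume "u = x @ a # y"
  from ef_stepD[OF assms(1) this] obtain x' y' where 1: "v = x' @ a # y'" "R x x'" "R y y'" .
  from ef_stepD[OF assms(2) 1(1)] obtain x'' y'' where "w = x'' @ a # y''" "R x' x''" "R y' y''" .
  with 1 assms(3) show "\<exists>x' y'. w = x' @ a # y' \<and> R x x' \<and> R y y'" by blast
qed

lemma ef_equiv_trans: "ef_equiv k u v \<Longrightarrow> ef_equiv k v w \<Longrightarrow> ef_equiv k u w"
proof (induction k arbitrary: u v w)
  case (Suc k)
  then show ?case by (auto intro: ef_step_trans[OF _ _ Suc.IH])
qed simp

lemma ef_equiv_Suc_imp: "ef_equiv (Suc k) u v \<Longrightarrow> ef_equiv k u v"
proof (induction k arbitrary: u v)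
  case (Suc k)
  then have "ef_step (ef_equiv (Suc k)) u v" "ef_step (ef_equiv (Suc k)) v u"
    unfolding ef_equiv.simps(2)[of "Suc k"] by blast+
  then have "ef_step (ef_equiv k) u v" "ef_step (ef_equiv k) v u"
    using Suc.IH ef_step_mono by blast+
  then show ?case by simp
qed simp

lemma append_eq_append_Cons_cases:
  fixes u :: "'a list"
  assumes "u @ v = x @ a # y"
  obtains y' where "u = x @ a # y'" "y = y' @ v"
    | x' where "v = x' @ a # y" "x = u @ x'"
proof -
  from assms consider us where "u = x @ us" "us @ v = a # y"
    | us where "u @ us = x" "v = us @ a # y"
    unfolding append_eq_append_conv2 by blast
  then show thesis
  proof cases
    case (1 us)
    then show thesis using that by (cases us) auto
  next
    case (2 us)
    then show thesis using that by auto
  qed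
qed

text \<open>Strategies compose: a letter chosen in one factor is answered in the corresponding
  factor, and the untouched factor is needed only one level lower. Hence equivalence is a congruence
  for concatenation.\<close>

lemma ef_equiv_append:
  "ef_equiv k u u' \<Longrightarrow> ef_equiv k v v' \<Longrightarrow> ef_equiv k (u @ v) (u' @ v')"
proof (induction k arbitrary: u u' v v')
  case (Suc k)
  have "ef_step (ef_equiv k) (u @ v) (u' @ v')"
    if u: "ef_equiv (Suc k) u u'" and v: "ef_equiv (Suc k) v v'" for u u' v v' :: "'a list"
    unfolding ef_step_def
  proof (intro allI impI)
    fix x a y assume "u @ v = x @ a # y"
    then show "\<exists>x' y'. u' @ v' = x' @ a # y' \<and> ef_equiv k x x' \<and> ef_equiv k y y'"
    proof (cases rule: append_eq_append_Cons_cases)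
      case (1 y0)
      obtain x' y' where *: "u' = x' @ a # y'" "ef_equiv k x x'" "ef_equiv k y0 y'"
        using ef_equiv_SucE[OF u 1(1)] .
      have "ef_equiv k y (y' @ v')"
        using 1 Suc.IH[OF *(3) ef_equiv_Suc_imp[OF v]] by simp
      with * show ?thesis by (intro exI[of _ x'] exI[of _ "y' @ v'"]) simp
    next
      case (2 x0)
      obtain x' y' where *: "v' = x' @ a # y'" "ef_equiv k x0 x'" "ef_equiv k y y'"
        using ef_equiv_SucE[OF v 2(1)] .
      have "ef_equiv k x (u' @ x')"
        using 2 Suc.IH[OF ef_equiv_Suc_imp[OF u] *(2)] by simp
      with * show ?thesis by (intro exI[of _ "u' @ x'"] exI[of _ y']) simp
    qed
  qed
  with Suc.prems ef_equiv_sym show ?case by (metis ef_equiv.simps(2))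
qed simp

text \<open>Any answer in the game remains one after relabelling. This serves to change the sets of
  variables recorded at the letters.\<close>

lemma ef_equiv_map: "ef_equiv k u v \<Longrightarrow> ef_equiv k (map g u) (map g v)"
proof (induction k arbitrary: u v)
  case (Suc k)
  have "ef_step (ef_equiv k) (map g u) (map g v)"
    if uv: "ef_step (ef_equiv k) u v" for u v
    unfolding ef_step_def
  proof (intro allI impI)
    fix x a y assume "map g u = x @ a # y"
    then obtain x0 a0 y0 where *: "u = x0 @ a0 # y0" "x = map g x0" "a = g a0" "y = map g y0"
      by (auto simp: map_eq_append_conv map_eq_Cons_conv)
    obtain x1 y1 where "v = x1 @ a0 # y1" "ef_equiv k x0 x1" "ef_equiv k y0 y1"
      using ef_stepD[OF uv *(1)] .
    then show "\<exists>x' y'. map g v = x' @ a # y' \<and> ef_equiv k x x' \<and> ef_equiv k y y'"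
      using * Suc.IH by (intro exI[of _ "map g x1"] exI[of _ "map g y1"]) simp
  qed
  with Suc.prems show ?case by simp
qed simp

section \<open>Finiteness of the number of classes\<close>

definition ef_class :: "nat \<Rightarrow> 'a list \<Rightarrow> 'a list set" where
  "ef_class k u = {v. ef_equiv k u v}"

lemma ef_class_eq_iff: "ef_class k u = ef_class k v \<longleftrightarrow> ef_equiv k u v"
  unfolding ef_class_def using ef_equiv_refl ef_equiv_sym ef_equiv_trans by blast

text \<open>The class of a word at level \<open>Suc k\<close> is determined by the set
  \<open>T\<close> of triples formed by the class of the left factor, the letter and the class of
  the right factor over all cuts. By induction and finiteness of the alphabet there are finitely
  many such sets.\<close>

lemma finite_ef_classes: "finite (range (ef_class k :: 'a::finite list \<Rightarrow> _))"
proof (induction k)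
  case 0
  have "range (ef_class 0 :: 'a list \<Rightarrow> _) = {UNIV}" by (auto simp: ef_class_def)
  then show ?case by simp
next
  case (Suc k)
  define T where "T u = {(ef_class k x, a, ef_class k y) | x a y. u = x @ a # y}" for u :: "'a list"
  have step: "ef_step (ef_equiv k) u v \<longleftrightarrow> T u \<subseteq> T v" for u v
  proof
    assume uv: "ef_step (ef_equiv k) u v"
    show "T u \<subseteq> T v"
    proof
      fix t assume "t \<in> T u"
      then obtain x a y where t: "t = (ef_class k x, a, ef_class k y)" "u = x @ a # y"
        unfolding T_def by blast
      from ef_stepD[OF uv t(2)] obtain x' y'
        where "v = x' @ a # y'" "ef_equiv k x x'" "ef_equiv k y y'" .
      then have "t = (ef_class k x', a, ef_class k y')" "v = x' @ a # y'"
        using t(1) by (simp_all add: ef_class_eq_iff)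
      then show "t \<in> T v" unfolding T_def by blast
    qed
  next
    assume sub: "T u \<subseteq> T v"
    show "ef_step (ef_equiv k) u v"
      unfolding ef_step_def
    proof (intro allI impI)
      fix x a y assume "u = x @ a # y"
      then have "(ef_class k x, a, ef_class k y) \<in> T v" using sub unfolding T_def by blast
      then obtain x' y' where "v = x' @ a # y'" "ef_class k x = ef_class k x'"
        "ef_class k y = ef_class k y'"
        unfolding T_def by blast
      then show "\<exists>x' y'. v = x' @ a # y' \<and> ef_equiv k x x' \<and> ef_equiv k y y'"
        unfolding ef_class_eq_iff by blast
    qed
  qed
  have "range (ef_class (Suc k)) \<subseteq>
      (\<lambda>t. {v. T v = t}) ` Pow (range (ef_class k) \<times> UNIV \<times> range (ef_class k))"
  proof
    fix C assume "C \<in> range (ef_class (Suc k) :: 'a list \<Rightarrow> _)"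
    then obtain u where "C = ef_class (Suc k) u" by blast
    then have "C = {v. T v = T u}" by (auto simp: ef_class_def step)
    moreover have "T u \<in> Pow (range (ef_class k) \<times> UNIV \<times> range (ef_class k))"
      unfolding T_def by blast
    ultimately show "C \<in> (\<lambda>t. {v. T v = t}) ` Pow (range (ef_class k) \<times> UNIV \<times> range (ef_class k))"
      by (rule image_eqI)
  qed
  moreover have "finite (Pow (range (ef_class k :: 'a list \<Rightarrow> _) \<times> (UNIV :: 'a set) \<times>
      range (ef_class k :: 'a list \<Rightarrow> _)))"
    using Suc by simp
  ultimately show ?case by (rule finite_surj[rotated])
qed

section \<open>Long powers of a word are equivalent\<close>

lemma concat_replicate_split:
  assumes "concat (replicate n u) = x @ a # y"
  shows "\<exists>i j p q. n = i + 1 + j \<and> u = p @ a # q \<and>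
    x = concat (replicate i u) @ p \<and> y = q @ concat (replicate j u)"
  using assms
proof (induction n arbitrary: x)
  case (Suc n)
  then have "u @ concat (replicate n u) = x @ a # y" by simp
  then show ?case
  proof (cases rule: append_eq_append_Cons_cases)
    case (1 y')
    then show ?thesis
      by (intro exI[of _ 0] exI[of _ n] exI[of _ x] exI[of _ y']) (simp only:, simp)
  next
    case (2 x')
    from Suc.IH[OF 2(1)] obtain i j p q where *: "n = i + 1 + j" "u = p @ a # q"
      "x' = concat (replicate i u) @ p" "y = q @ concat (replicate j u)"
      by blast
    have "x = concat (replicate (Suc i) u) @ p" using 2(2) *(3) by simp
    moreover have "Suc n = Suc i + 1 + j" using *(1) by simp
    ultimately show ?thesis using *(2,4) by blast
  qed
qed simp

lemma concat_replicate_join: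
  assumes "u = p @ a # q"
  shows "concat (replicate (i + 1 + j) u) =
    (concat (replicate i u) @ p) @ a # (q @ concat (replicate j u))"
proof -
  have "concat (replicate (i + 1 + j) u) = concat (replicate i u) @ u @ concat (replicate j u)"
    unfolding add.assoc replicate_add concat_append by simp
  then show ?thesis by (subst (asm) (3) assms) simp
qed

text \<open>With at least \<open>2 ^ Suc k - 1\<close> factors, one side of any split still has \<open>2 ^ k - 1\<close> of them,
  so a factor can be inserted or dropped there.\<close>

lemma ef_equiv_replicate_Suc:
  "2 ^ k \<le> Suc n \<Longrightarrow> ef_equiv k (concat (replicate n u)) (concat (replicate (Suc n) u))"
proof (induction k arbitrary: n)
  case (Suc k)
  define r where "r n = concat (replicate n u)" for n
  have IH: "ef_equiv k (r i) (r (Suc i))" if "2 ^ k \<le> Suc i" for i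
    using Suc.IH[OF that] unfolding r_def .
  have split: "\<exists>i j p q. n = i + 1 + j \<and> u = p @ a # q \<and> x = r i @ p \<and> y = q @ r j"
    if "r n = x @ a # y" for n x a y
    using concat_replicate_split that unfolding r_def .
  have join: "r (i + 1 + j) = (r i @ p) @ a # (q @ r j)" if "u = p @ a # q" for i j p a q
    using concat_replicate_join[OF that] unfolding r_def .
  have "ef_step (ef_equiv k) (r n) (r (Suc n))"
    unfolding ef_step_def
  proof (intro allI impI)
    fix x a y assume "r n = x @ a # y"
    from split[OF this] obtain i j p q
      where n: "n = i + 1 + j" and u: "u = p @ a # q" and x: "x = r i @ p" and y: "y = q @ r j"
      by blast
    have "2 ^ k \<le> Suc i \<or> 2 ^ k \<le> Suc j" using Suc.prems n by auto
    then show "\<exists>x' y'. r (Suc n) = x' @ a # y' \<and> ef_equiv k x x' \<and> ef_equiv k y y'"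
    proof
      assume i: "2 ^ k \<le> Suc i"
      have "r (Suc n) = (r (Suc i) @ p) @ a # y"
        using join[OF u, of "Suc i" j] n y by simp
      moreover have "ef_equiv k x (r (Suc i) @ p)"
        unfolding x by (intro ef_equiv_append IH i ef_equiv_refl)
      ultimately show ?thesis using ef_equiv_refl by blast
    next
      assume j: "2 ^ k \<le> Suc j"
      have "r (Suc n) = x @ a # (q @ r (Suc j))"
        using join[OF u, of i "Suc j"] n x by simp
      moreover have "ef_equiv k y (q @ r (Suc j))"
        unfolding y by (intro ef_equiv_append IH j ef_equiv_refl)
      ultimately show ?thesis using ef_equiv_refl by blast
    qed
  qed
  moreover have "ef_step (ef_equiv k) (r (Suc n)) (r n)"
    unfolding ef_step_def
  proof (intro allI impI)
    fix x a y assume "r (Suc n) = x @ a # y"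
    from split[OF this] obtain i j p q
      where n: "Suc n = i + 1 + j" and u: "u = p @ a # q" and x: "x = r i @ p" and y: "y = q @ r j"
      by blast
    \<comment> \<open>Here \<open>i + j = n\<close> is at least \<open>2 ^ Suc k - 1\<close>, so one
      side has \<open>2 ^ k\<close> copies and still \<open>2 ^ k - 1\<close> after one is
      dropped.\<close>
    have "2 ^ k \<le> i \<or> 2 ^ k \<le> j" using Suc.prems n by auto
    then show "\<exists>x' y'. r n = x' @ a # y' \<and> ef_equiv k x x' \<and> ef_equiv k y y'"
    proof
      assume "2 ^ k \<le> i"
      then obtain i' where i': "i = Suc i'" "2 ^ k \<le> Suc i'" by (cases i) auto
      have "r n = (r i' @ p) @ a # y"
        using join[OF u, of i' j] n y i' by simp
      moreover have "ef_equiv k x (r i' @ p)"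
        unfolding x i'(1) by (intro ef_equiv_append ef_equiv_sym[OF IH] i'(2) ef_equiv_refl)
      ultimately show ?thesis using ef_equiv_refl by blast
    next
      assume "2 ^ k \<le> j"
      then obtain j' where j': "j = Suc j'" "2 ^ k \<le> Suc j'" by (cases j) auto
      have "r n = x @ a # (q @ r j')"
        using join[OF u, of i j'] n x j' by simp
      moreover have "ef_equiv k y (q @ r j')"
        unfolding y j'(1) by (intro ef_equiv_append ef_equiv_sym[OF IH] j'(2) ef_equiv_refl)
      ultimately show ?thesis using ef_equiv_refl by blast
    qed
  qed
  ultimately show ?case by (simp add: r_def)
qed simp

section \<open>First-order formulas do not separate equivalent words\<close>

primrec fo_rank :: "'a fo \<Rightarrow> nat" where
  "fo_rank (FLess x y) = 0"
| "fo_rank (FEq x y) = 0"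
| "fo_rank (FLetter a x) = 0"
| "fo_rank (FNot \<phi>) = fo_rank \<phi>"
| "fo_rank (FOr \<phi> \<psi>) = max (fo_rank \<phi>) (fo_rank \<psi>)"
| "fo_rank (FAnd \<phi> \<psi>) = max (fo_rank \<phi>) (fo_rank \<psi>)"
| "fo_rank (FEx x \<phi>) = Suc (fo_rank \<phi>)"
| "fo_rank (FAll x \<phi>) = Suc (fo_rank \<phi>)"

text \<open>An assignment of the variables in \<open>V\<close> is recorded in the word itself: each position
  carries the set of variables placed on it.\<close>

definition pebbled :: "'a list \<Rightarrow> (nat \<Rightarrow> nat) \<Rightarrow> nat set \<Rightarrow> ('a \<times> nat set) list" where
  "pebbled w v V = map (\<lambda>i. (letter_at w i, {x \<in> V. v x = i})) [1..<Suc (length w)]"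

lemma pebbled_empty: "pebbled w v {} = map (\<lambda>a. (a, {})) w"
  by (rule nth_equalityI) (simp_all add: pebbled_def letter_at_def del: upt_Suc)

lemma upt_split: "i \<in> dom_word w \<Longrightarrow>
  [1..<Suc (length w)] = [1..<i] @ i # [Suc i..<Suc (length w)]"
  using upt_add_eq_append[of 1 i "Suc (length w) - i"] upt_conv_Cons[of i "Suc (length w)"]
  by (simp add: dom_word_def del: upt_Suc)

lemma pebbled_split:
  assumes "i \<in> dom_word w"
  shows "pebbled w v V =
    map (\<lambda>i. (letter_at w i, {x \<in> V. v x = i})) [1..<i] @ (letter_at w i, {x \<in> V. v x = i}) #
    map (\<lambda>i. (letter_at w i, {x \<in> V. v x = i})) [Suc i..<Suc (length w)]"
  unfolding pebbled_def upt_split[OF assms] by simp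

text \<open>Variable names are reused, so \<open>x\<close> may already be recorded somewhere; it is
  erased on both sides before being placed at \<open>i\<close>.\<close>

lemma pebbled_update:
  assumes "i \<in> dom_word w" "pebbled w v V = U @ b # W" "length U = i - 1"
  shows "pebbled w (v(x := i)) (insert x V) =
    map (\<lambda>(a, S). (a, S - {x})) U @ (fst b, insert x (snd b)) # map (\<lambda>(a, S). (a, S - {x})) W"
proof -
  have *: "U = map (\<lambda>i. (letter_at w i, {x \<in> V. v x = i})) [1..<i]"
    "b = (letter_at w i, {x \<in> V. v x = i})"
    "W = map (\<lambda>i. (letter_at w i, {x \<in> V. v x = i})) [Suc i..<Suc (length w)]"
    using assms(2,3) pebbled_split[OF assms(1), of v V] by (simp_all del: upt_Suc)
  show ?thesis unfolding pebbled_split[OF assms(1)] * by auto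
qed

lemma length_pebbled: "length (pebbled w v V) = length w"
  by (simp add: pebbled_def del: upt_Suc)

text \<open>A quantifier is a move of the game. After the answer, erasing \<open>x\<close> from the
  factors is a relabelling, and the pieces are put together again by the congruence for
  concatenation.\<close>

lemma pebbled_extend:
  assumes "ef_equiv (Suc k) (pebbled w v V) (pebbled w' v' V)" "i \<in> dom_word w"
  shows "\<exists>i' \<in> dom_word w'.
    ef_equiv k (pebbled w (v(x := i)) (insert x V)) (pebbled w' (v'(x := i')) (insert x V))"
proof -
  let ?g = "\<lambda>(a, S). (a, S - {x})"
  obtain U b W where UbW: "pebbled w v V = U @ b # W" "length U = i - 1"
    using pebbled_split[OF assms(2), of v V] by force
  obtain U' W' where UbW': "pebbled w' v' V = U' @ b # W'"
    and eq: "ef_equiv k U U'" "ef_equiv k W W'"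
    using ef_equiv_SucE[OF assms(1) UbW(1)] .
  \<comment> \<open>The answer is the 1-based position of the matching letter
    \<open>b\<close>.\<close>
  define i' where "i' = Suc (length U')"
  have "length w' = length U' + 1 + length W'"
    using arg_cong[OF UbW', of length] by (simp add: length_pebbled)
  then have i': "i' \<in> dom_word w'" by (simp add: i'_def dom_word_def)
  have "ef_equiv k (map ?g U @ [(fst b, insert x (snd b))] @ map ?g W)
      (map ?g U' @ [(fst b, insert x (snd b))] @ map ?g W')"
    by (intro ef_equiv_append ef_equiv_map eq ef_equiv_refl)
  then have "ef_equiv k (pebbled w (v(x := i)) (insert x V)) (pebbled w' (v'(x := i')) (insert x V))"
    using pebbled_update[OF assms(2) UbW, of x] pebbled_update[OF i' UbW', of x]
    by (simp add: i'_def)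
  with i' show ?thesis by blast
qed

text \<open>Atoms are restated as the existence of cuts of the pebbled word, which is the kind of
  property that \<open>ef_equiv\<close> preserves. This atom and equality take one cut; the order
  takes a second cut inside the right factor of the first.\<close>

lemma pebbled_letter_iff:
  assumes "v x \<in> dom_word w" "x \<in> V"
  shows "letter_at w (v x) = a \<longleftrightarrow> (\<exists>U b W. pebbled w v V = U @ b # W \<and> x \<in> snd b \<and> fst b = a)"
    (is "_ \<longleftrightarrow> ?r")
proof -
  have "?r \<longleftrightarrow> (\<exists>b \<in> set (pebbled w v V). x \<in> snd b \<and> fst b = a)"
    by (metis in_set_conv_decomp)
  also have "\<dots> \<longleftrightarrow> letter_at w (v x) = a"
    using assms by (auto simp: pebbled_def dom_word_def)
  finally show ?thesis by simp
qed

lemma pebbled_eq_iff: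
  assumes "v x \<in> dom_word w" "x \<in> V" "y \<in> V"
  shows "v x = v y \<longleftrightarrow> (\<exists>U b W. pebbled w v V = U @ b # W \<and> x \<in> snd b \<and> y \<in> snd b)"
    (is "_ \<longleftrightarrow> ?r")
proof -
  have "?r \<longleftrightarrow> (\<exists>b \<in> set (pebbled w v V). x \<in> snd b \<and> y \<in> snd b)"
    by (metis in_set_conv_decomp)
  also have "\<dots> \<longleftrightarrow> v x = v y"
    using assms by (auto simp: pebbled_def dom_word_def)
  finally show ?thesis by simp
qed

lemma pebbled_less_iff:
  assumes "v x \<in> dom_word w" "v y \<in> dom_word w" "x \<in> V" "y \<in> V"
  shows "v x < v y \<longleftrightarrow> (\<exists>U b W. pebbled w v V = U @ b # W \<and> x \<in> snd b \<and>
    (\<exists>X c Y. W = X @ c # Y \<and> y \<in> snd c))"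
    (is "_ \<longleftrightarrow> ?r")
proof -
  have r: "?r \<longleftrightarrow> (\<exists>U b W. pebbled w v V = U @ b # W \<and> x \<in> snd b \<and> (\<exists>c \<in> set W. y \<in> snd c))"
    by (metis in_set_conv_decomp)
  show ?thesis unfolding r
  proof
    assume "v x < v y"
    then show "\<exists>U b W. pebbled w v V = U @ b # W \<and> x \<in> snd b \<and> (\<exists>c \<in> set W. y \<in> snd c)"
      using assms pebbled_split[OF assms(1), of v V] by (fastforce simp: dom_word_def)
  next
    assume "\<exists>U b W. pebbled w v V = U @ b # W \<and> x \<in> snd b \<and> (\<exists>c \<in> set W. y \<in> snd c)"
    then obtain U b W c where *: "pebbled w v V = U @ b # W" "x \<in> snd b" "c \<in> set W" "y \<in> snd c"
      by blast
    define i where "i = Suc (length U)"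
    have "length w = length U + 1 + length W"
      using arg_cong[OF *(1), of length] by (simp add: length_pebbled)
    then have i: "i \<in> dom_word w" by (simp add: i_def dom_word_def)
    have "b = (letter_at w i, {x \<in> V. v x = i})"
      "W = map (\<lambda>i. (letter_at w i, {x \<in> V. v x = i})) [Suc i..<Suc (length w)]"
      using *(1) pebbled_split[OF i, of v V] by (simp_all add: i_def del: upt_Suc)
    then show "v x < v y" using *(2-4) by auto
  qed
qed

text \<open>Each quantifier spends one level. Level 0 relates all words, so two further levels are
  kept for the atoms, \<open>x < y\<close> being tested by two nested cuts.\<close>

lemma fo_sat_cong_ef_equiv:
  assumes "ef_equiv k (pebbled w v V) (pebbled w' v' V)" "fo_rank \<phi> + 2 \<le> k"
    and "fo_free \<phi> \<subseteq> V" "\<forall>x\<in>V. v x \<in> dom_word w" "\<forall>x\<in>V. v' x \<in> dom_word w'"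
  shows "fo_sat w v \<phi> \<longleftrightarrow> fo_sat w' v' \<phi>"
  using assms
proof (induction \<phi> arbitrary: v v' V k)
  case (FLess x y)
  let ?L = "\<lambda>u. \<exists>U b W. u = U @ b # W \<and> x \<in> snd b \<and> (\<exists>X c Y. W = X @ c # Y \<and> y \<in> snd c)"
  obtain d where k: "k = Suc (Suc d)"
    using FLess.prems(2) by (metis add_2_eq_Suc' le_iff_add fo_rank.simps(1) add_2_eq_Suc add_0)
  have L: "?L u'" if uu: "ef_equiv (Suc (Suc d)) u u'" and "?L u" for u u' :: "('a \<times> nat set) list"
  proof -
    obtain U b X c Y where *: "u = U @ b # X @ c # Y" "x \<in> snd b" "y \<in> snd c"
      using \<open>?L u\<close> by blast
    obtain U' W' where 1: "u' = U' @ b # W'" "ef_equiv (Suc d) (X @ c # Y) W'"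
      using ef_equiv_SucE[OF uu *(1)] .
    obtain X' Y' where "W' = X' @ c # Y'"
      using ef_equiv_SucE[OF 1(2) refl] .
    with 1 * show ?thesis by blast
  qed
  have "?L (pebbled w v V) \<longleftrightarrow> ?L (pebbled w' v' V)"
    using L[OF FLess.prems(1)[unfolded k]] L[OF ef_equiv_sym[OF FLess.prems(1)[unfolded k]]] by blast
  then show ?case
    using FLess.prems(3-5) pebbled_less_iff[of v x w y V] pebbled_less_iff[of v' x w' y V] by simp
next
  case (FEq x y)
  let ?L = "\<lambda>u. \<exists>U b W. u = U @ b # W \<and> x \<in> snd b \<and> y \<in> snd b"
  obtain d where k: "k = Suc d" using FEq.prems(2) by (cases k) auto
  have L: "?L u'" if "ef_equiv (Suc d) u u'" "?L u" for u u' :: "('a \<times> nat set) list"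
    using that ef_equiv_SucE by metis
  have "?L (pebbled w v V) \<longleftrightarrow> ?L (pebbled w' v' V)"
    using L[OF FEq.prems(1)[unfolded k]] L[OF ef_equiv_sym[OF FEq.prems(1)[unfolded k]]] by blast
  then show ?case
    using FEq.prems(3-5) pebbled_eq_iff[of v x w V y] pebbled_eq_iff[of v' x w' V y] by simp
next
  case (FLetter a x)
  let ?L = "\<lambda>u. \<exists>U b W. u = U @ b # W \<and> x \<in> snd b \<and> fst b = a"
  obtain d where k: "k = Suc d" using FLetter.prems(2) by (cases k) auto
  have L: "?L u'" if "ef_equiv (Suc d) u u'" "?L u" for u u' :: "('a \<times> nat set) list"
    using that ef_equiv_SucE by metis
  have "?L (pebbled w v V) \<longleftrightarrow> ?L (pebbled w' v' V)"
    using L[OF FLetter.prems(1)[unfolded k]] L[OF ef_equiv_sym[OF FLetter.prems(1)[unfolded k]]]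
    by blast
  then show ?case
    using FLetter.prems(3-5) pebbled_letter_iff[of v x w V a] pebbled_letter_iff[of v' x w' V a] by simp
next
  case (FNot \<phi>)
  show ?case using FNot.IH[OF FNot.prems(1)] FNot.prems(2-) by simp
next
  case (FOr \<phi> \<psi>)
  show ?case using FOr.IH[OF FOr.prems(1)] FOr.prems(2-) by simp
next
  case (FAnd \<phi> \<psi>)
  show ?case using FAnd.IH[OF FAnd.prems(1)] FAnd.prems(2-) by simp
next
  case (FEx x \<phi>)
  obtain d where k: "k = Suc d" "fo_rank \<phi> + 2 \<le> d" using FEx.prems(2) by (cases k) auto
  note e = FEx.prems(1)[unfolded k(1)]
  have IH: "fo_sat w (v(x := i)) \<phi> \<longleftrightarrow> fo_sat w' (v'(x := i')) \<phi>"
    if "i \<in> dom_word w" "i' \<in> dom_word w'"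
      "ef_equiv d (pebbled w (v(x := i)) (insert x V)) (pebbled w' (v'(x := i')) (insert x V))" for i i'
    using FEx.prems(3-5) that(1,2) by (intro FEx.IH[OF that(3) k(2)]) auto
  have "\<exists>i'\<in>dom_word w'. fo_sat w (v(x := i)) \<phi> = fo_sat w' (v'(x := i')) \<phi>" if "i \<in> dom_word w" for i
    using pebbled_extend[OF e that, of x] IH[OF that] by blast
  moreover have "\<exists>i\<in>dom_word w. fo_sat w (v(x := i)) \<phi> = fo_sat w' (v'(x := i')) \<phi>"
    if "i' \<in> dom_word w'" for i'
    using pebbled_extend[OF ef_equiv_sym[OF e] that, of x] IH[OF _ that] ef_equiv_sym by blast
  ultimately show ?case by (simp only: fo_sat.simps) meson
next
  case (FAll x \<phi>)
  obtain d where k: "k = Suc d" "fo_rank \<phi> + 2 \<le> d" using FAll.prems(2) by (cases k) auto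
  note e = FAll.prems(1)[unfolded k(1)]
  have IH: "fo_sat w (v(x := i)) \<phi> \<longleftrightarrow> fo_sat w' (v'(x := i')) \<phi>"
    if "i \<in> dom_word w" "i' \<in> dom_word w'"
      "ef_equiv d (pebbled w (v(x := i)) (insert x V)) (pebbled w' (v'(x := i')) (insert x V))" for i i'
    using FAll.prems(3-5) that(1,2) by (intro FAll.IH[OF that(3) k(2)]) auto
  have "\<exists>i'\<in>dom_word w'. fo_sat w (v(x := i)) \<phi> = fo_sat w' (v'(x := i')) \<phi>" if "i \<in> dom_word w" for i
    using pebbled_extend[OF e that, of x] IH[OF that] by blast
  moreover have "\<exists>i\<in>dom_word w. fo_sat w (v(x := i)) \<phi> = fo_sat w' (v'(x := i')) \<phi>"
    if "i' \<in> dom_word w'" for i'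
    using pebbled_extend[OF ef_equiv_sym[OF e] that, of x] IH[OF _ that] ef_equiv_sym by blast
  ultimately show ?case by (simp only: fo_sat.simps) meson
qed

lemma fo_sentence_cong_ef_equiv:
  assumes "fo_sentence \<phi>" "ef_equiv (fo_rank \<phi> + 2) w w'"
  shows "fo_sat w v \<phi> \<longleftrightarrow> fo_sat w' v \<phi>"
  using ef_equiv_map[OF assms(2), of "\<lambda>a. (a, {})"] assms(1)
  by (intro fo_sat_cong_ef_equiv[where k = "fo_rank \<phi> + 2" and V = "{}"])
     (simp_all only: fo_sentence_def pebbled_empty order.refl empty_subsetI ball_empty)

section \<open>Properties of positions expressible in temporal logic\<close>

text \<open>Semantic properties replace formulas, so that the formulas built in the induction never
  have to be written down.\<close>

definition ltl_expressible :: "('a list \<Rightarrow> nat \<Rightarrow> bool) \<Rightarrow> bool" where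
  "ltl_expressible P \<longleftrightarrow> (\<exists>\<phi>. \<forall>w. \<forall>i\<in>dom_word w. ltl_sat w i \<phi> \<longleftrightarrow> P w i)"

definition until ::
  "('a list \<Rightarrow> nat \<Rightarrow> bool) \<Rightarrow> ('a list \<Rightarrow> nat \<Rightarrow> bool) \<Rightarrow> 'a list \<Rightarrow> nat \<Rightarrow> bool" where
  "until P Q w i \<longleftrightarrow> (\<exists>m\<in>dom_word w. i < m \<and> Q w m \<and> (\<forall>l. i < l \<and> l < m \<longrightarrow> P w l))"

text \<open>The one-step expansion matches the recursion of \<open>segment_product\<close>, so both
  can be handled by induction on \<open>length w - i\<close>.\<close>

lemma until_unfold:
  "until P Q w i \<longleftrightarrow> i < length w \<and> (Q w (Suc i) \<or> P w (Suc i) \<and> until P Q w (Suc i))"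
  (is "?l \<longleftrightarrow> ?r")
proof
  assume ?l
  then obtain m where m: "m \<in> dom_word w" "i < m" "Q w m" "\<forall>l. i < l \<and> l < m \<longrightarrow> P w l"
    unfolding until_def by blast
  show ?r
  proof (cases "m = Suc i")
    case True
    with m show ?thesis by (simp add: dom_word_def)
  next
    case False
    then have "Suc i < m" using m by simp
    moreover have "\<forall>l. Suc i < l \<and> l < m \<longrightarrow> P w l" using m(4) by simp
    ultimately show ?thesis using m unfolding until_def by (auto simp: dom_word_def)
  qed
next
  assume r: ?r
  show ?l
  proof (cases "Q w (Suc i)")
    case True
    with r show ?thesis unfolding until_def by (intro bexI[of _ "Suc i"]) (auto simp: dom_word_def)
  next
    case False
    with r obtain m where m: "m \<in> dom_word w" "Suc i < m" "Q w m" "P w (Suc i)"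
      "\<forall>l. Suc i < l \<and> l < m \<longrightarrow> P w l"
      unfolding until_def by blast
    have "P w l" if "i < l" "l < m" for l
      using that m by (cases "l = Suc i") auto
    with m show ?thesis unfolding until_def by (intro bexI[of _ m]) auto
  qed
qed

lemma ltl_expressible_cong:
  "ltl_expressible P \<Longrightarrow> (\<And>w i. P w i \<longleftrightarrow> Q w i) \<Longrightarrow> ltl_expressible Q"
  unfolding ltl_expressible_def by simp

lemma ltl_expressible_letter: "ltl_expressible (\<lambda>w i. letter_at w i = a)"
  unfolding ltl_expressible_def by (rule exI[of _ "LLetter a"]) simp

lemma ltl_expressible_const: "ltl_expressible (\<lambda>w i. b)"
  unfolding ltl_expressible_def
  by (cases b) (auto intro: exI[of _ LTop] exI[of _ "LNot LTop"])

lemma ltl_expressible_not: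
  assumes "ltl_expressible P"
  shows "ltl_expressible (\<lambda>w i. \<not> P w i)"
proof -
  obtain \<phi> where "\<forall>w. \<forall>i\<in>dom_word w. ltl_sat w i \<phi> \<longleftrightarrow> P w i"
    using assms unfolding ltl_expressible_def by blast
  then show ?thesis unfolding ltl_expressible_def by (intro exI[of _ "LNot \<phi>"]) simp
qed

lemma ltl_expressible_disj:
  assumes "ltl_expressible P" "ltl_expressible Q"
  shows "ltl_expressible (\<lambda>w i. P w i \<or> Q w i)"
proof -
  obtain \<phi> \<psi> where "\<forall>w. \<forall>i\<in>dom_word w. ltl_sat w i \<phi> \<longleftrightarrow> P w i"
    "\<forall>w. \<forall>i\<in>dom_word w. ltl_sat w i \<psi> \<longleftrightarrow> Q w i"
    using assms unfolding ltl_expressible_def by blast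
  then show ?thesis unfolding ltl_expressible_def by (intro exI[of _ "LOr \<phi> \<psi>"]) simp
qed

lemma ltl_expressible_conj:
  assumes "ltl_expressible P" "ltl_expressible Q"
  shows "ltl_expressible (\<lambda>w i. P w i \<and> Q w i)"
  using ltl_expressible_not[OF ltl_expressible_disj[OF assms[THEN ltl_expressible_not]]] by simp

lemma ltl_expressible_until:
  assumes "ltl_expressible P" "ltl_expressible Q"
  shows "ltl_expressible (until P Q)"
proof -
  obtain \<phi> \<psi> where *: "\<forall>w. \<forall>i\<in>dom_word w. ltl_sat w i \<phi> \<longleftrightarrow> P w i"
    "\<forall>w. \<forall>i\<in>dom_word w. ltl_sat w i \<psi> \<longleftrightarrow> Q w i"
    using assms unfolding ltl_expressible_def by blast
  have "ltl_sat w i (LUntil \<phi> \<psi>) \<longleftrightarrow> until P Q w i" for w i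
  proof -
    have "l \<in> dom_word w" if "i < l" "l < m" "m \<in> dom_word w" for l m
      using that by (auto simp: dom_word_def)
    with * show ?thesis unfolding ltl_sat.simps until_def by blast
  qed
  then show ?thesis unfolding ltl_expressible_def by blast
qed

text \<open>A finite disjunction guesses the value of a labelling in a finite monoid.\<close>

lemma ltl_expressible_bex:
  assumes "finite S" "\<And>x. x \<in> S \<Longrightarrow> ltl_expressible (P x)"
  shows "ltl_expressible (\<lambda>w i. \<exists>x\<in>S. P x w i)"
  using assms
proof (induction S)
  case empty
  show ?case using ltl_expressible_const[of False] by simp
next
  case (insert x S)
  then have "ltl_expressible (\<lambda>w i. P x w i \<or> (\<exists>x\<in>S. P x w i))"
    by (intro ltl_expressible_disj) auto
  then show ?case by simp
qed

lemmas ltl_expressible_intros = ltl_expressible_const ltl_expressible_not ltl_expressible_disj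
  ltl_expressible_conj ltl_expressible_until ltl_expressible_bex

section \<open>Local divisors of aperiodic monoids\<close>

definition aperiodic :: "('m, 'b) monoid_scheme \<Rightarrow> bool" where
  "aperiodic G \<longleftrightarrow> (\<forall>x\<in>carrier G. \<exists>n::nat. x [^]\<^bsub>G\<^esub> Suc n = x [^]\<^bsub>G\<^esub> n)"

text \<open>The product of \<open>x\<close> and \<open>c \<otimes> y\<close> is \<open>x \<otimes> y\<close>; it does not depend on the
  choice of \<open>y\<close> because \<open>x\<close> is a left multiple of \<open>c\<close>.\<close>

definition local_divisor :: "('m, 'b) monoid_scheme \<Rightarrow> 'm \<Rightarrow> 'm monoid" where
  "local_divisor G c =
     \<lparr>carrier = {x. (\<exists>y\<in>carrier G. x = c \<otimes>\<^bsub>G\<^esub> y) \<and> (\<exists>y\<in>carrier G. x = y \<otimes>\<^bsub>G\<^esub> c)},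
      mult = (\<lambda>x z. x \<otimes>\<^bsub>G\<^esub> (SOME y. y \<in> carrier G \<and> z = c \<otimes>\<^bsub>G\<^esub> y)),
      one = c\<rparr>"

context monoid
begin

lemma local_divisor_carrierE:
  assumes "x \<in> carrier (local_divisor G c)"
  obtains y z where "y \<in> carrier G" "x = c \<otimes> y" "z \<in> carrier G" "x = z \<otimes> c"
  using assms by (auto simp: local_divisor_def)

lemma local_divisor_carrierI:
  "y \<in> carrier G \<Longrightarrow> z \<in> carrier G \<Longrightarrow> x = c \<otimes> y \<Longrightarrow> x = z \<otimes> c \<Longrightarrow>
    x \<in> carrier (local_divisor G c)"
  unfolding local_divisor_def partial_object.select_convs by blast

lemma local_divisor_subset: "c \<in> carrier G \<Longrightarrow> carrier (local_divisor G c) \<subseteq> carrier G"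
  by (auto simp: local_divisor_def)

lemma one_local_divisor: "\<one>\<^bsub>local_divisor G c\<^esub> = c"
  by (simp add: local_divisor_def)

lemma mult_local_divisor:
  assumes c: "c \<in> carrier G" and x: "x \<in> carrier (local_divisor G c)" and y: "y \<in> carrier G"
  shows "x \<otimes>\<^bsub>local_divisor G c\<^esub> (c \<otimes> y) = x \<otimes> y"
proof -
  obtain z where z: "z \<in> carrier G" "x = z \<otimes> c" using x by (rule local_divisor_carrierE)
  define y' where "y' = (SOME y'. y' \<in> carrier G \<and> c \<otimes> y = c \<otimes> y')"
  have y': "y' \<in> carrier G" "c \<otimes> y = c \<otimes> y'"
    using someI[of "\<lambda>y'. y' \<in> carrier G \<and> c \<otimes> y = c \<otimes> y'" y] y unfolding y'_def by auto
  have "x \<otimes>\<^bsub>local_divisor G c\<^esub> (c \<otimes> y) = x \<otimes> y'"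
    by (simp add: local_divisor_def y'_def)
  \<comment> \<open>With \<open>x = z \<otimes> c\<close> the product sees \<open>y'\<close> only
    through \<open>c \<otimes> y'\<close>, so the choice made by \<open>SOME\<close> is
    immaterial.\<close>
  also have "\<dots> = z \<otimes> (c \<otimes> y')" using z y' c by (simp add: m_assoc)
  also have "\<dots> = x \<otimes> y" using z y c by (simp add: m_assoc flip: y'(2))
  finally show ?thesis .
qed

lemma sandwich_in_local_divisor:
  "c \<in> carrier G \<Longrightarrow> y \<in> carrier G \<Longrightarrow> c \<otimes> y \<otimes> c \<in> carrier (local_divisor G c)"
  by (rule local_divisor_carrierI[of "y \<otimes> c" "c \<otimes> y"]) (simp_all add: m_assoc)

lemma self_in_local_divisor: "c \<in> carrier G \<Longrightarrow> c \<in> carrier (local_divisor G c)"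
  by (rule local_divisor_carrierI[of \<one> \<one>]) simp_all

lemma monoid_local_divisor:
  assumes c: "c \<in> carrier G"
  shows "monoid (local_divisor G c)"
proof -
  let ?L = "local_divisor G c"
  have closed: "x \<otimes>\<^bsub>?L\<^esub> y \<in> carrier ?L" if x: "x \<in> carrier ?L" and y: "y \<in> carrier ?L" for x y
  proof -
    obtain x1 x2 where x12: "x1 \<in> carrier G" "x = c \<otimes> x1" "x2 \<in> carrier G" "x = x2 \<otimes> c"
      using x by (rule local_divisor_carrierE)
    obtain y1 y2 where y12: "y1 \<in> carrier G" "y = c \<otimes> y1" "y2 \<in> carrier G" "y = y2 \<otimes> c"
      using y by (rule local_divisor_carrierE)
    have "x \<otimes>\<^bsub>?L\<^esub> y = x \<otimes> y1" using mult_local_divisor[OF c x y12(1)] y12(2) by simp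
    moreover have "x \<otimes> y1 = c \<otimes> (x1 \<otimes> y1)" using x12(1,2) y12(1) c by (simp add: m_assoc)
    moreover have "x \<otimes> y1 = (x2 \<otimes> y2) \<otimes> c"
    proof -
      have "x \<otimes> y1 = x2 \<otimes> (c \<otimes> y1)" unfolding x12(4) using x12(3) y12(1) c by (simp add: m_assoc)
      also have "\<dots> = x2 \<otimes> (y2 \<otimes> c)" using y12 by simp
      finally show ?thesis using x12(3) y12(3) c by (simp add: m_assoc)
    qed
    ultimately show ?thesis
      using x12(1,3) y12(1,3) by (intro local_divisor_carrierI[of "x1 \<otimes> y1" "x2 \<otimes> y2"]) simp_all
  qed
  show ?thesis
  proof
    show "\<one>\<^bsub>?L\<^esub> \<in> carrier ?L" using self_in_local_divisor[OF c] by (simp add: one_local_divisor)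
    show "x \<otimes>\<^bsub>?L\<^esub> y \<in> carrier ?L" if "x \<in> carrier ?L" "y \<in> carrier ?L" for x y
      using closed that .
    show "\<one>\<^bsub>?L\<^esub> \<otimes>\<^bsub>?L\<^esub> x = x" if x: "x \<in> carrier ?L" for x
    proof -
      obtain y where y: "y \<in> carrier G" "x = c \<otimes> y" using x by (rule local_divisor_carrierE)
      show ?thesis
        using mult_local_divisor[OF c self_in_local_divisor[OF c] y(1)] y(2) by (simp add: one_local_divisor)
    qed
    show "x \<otimes>\<^bsub>?L\<^esub> \<one>\<^bsub>?L\<^esub> = x" if x: "x \<in> carrier ?L" for x
      using mult_local_divisor[OF c x one_closed] c local_divisor_subset[OF c] x
      by (simp add: one_local_divisor subset_iff)
    show "x \<otimes>\<^bsub>?L\<^esub> y \<otimes>\<^bsub>?L\<^esub> z = x \<otimes>\<^bsub>?L\<^esub> (y \<otimes>\<^bsub>?L\<^esub> z)"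
      if xyz: "x \<in> carrier ?L" "y \<in> carrier ?L" "z \<in> carrier ?L" for x y z
    proof -
      obtain y1 where y: "y1 \<in> carrier G" "y = c \<otimes> y1" using xyz(2) by (rule local_divisor_carrierE)
      obtain z1 where z: "z1 \<in> carrier G" "z = c \<otimes> z1" using xyz(3) by (rule local_divisor_carrierE)
      have x: "x \<in> carrier G" using local_divisor_subset[OF c] xyz(1) by blast
      have "x \<otimes>\<^bsub>?L\<^esub> y \<otimes>\<^bsub>?L\<^esub> z = (x \<otimes>\<^bsub>?L\<^esub> y) \<otimes> z1"
        using mult_local_divisor[OF c closed[OF xyz(1,2)] z(1)] z(2) by simp
      also have "\<dots> = x \<otimes> y1 \<otimes> z1"
        using mult_local_divisor[OF c xyz(1) y(1)] y(2) by simp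
      also have "\<dots> = x \<otimes>\<^bsub>?L\<^esub> (c \<otimes> (y1 \<otimes> z1))"
        using mult_local_divisor[OF c xyz(1), of "y1 \<otimes> z1"] x y z by (simp add: m_assoc)
      also have "c \<otimes> (y1 \<otimes> z1) = y \<otimes>\<^bsub>?L\<^esub> z"
        using mult_local_divisor[OF c xyz(2) z(1)] y z c by (simp add: m_assoc)
      finally show ?thesis .
    qed
  qed
qed

text \<open>The powers of \<open>c \<otimes> y\<close> in the local divisor are
  \<open>c \<otimes> y [^] n\<close>, which stabilise as soon as the powers of \<open>y\<close>
  do.\<close>

lemma aperiodic_local_divisor:
  assumes c: "c \<in> carrier G" and G: "aperiodic G"
  shows "aperiodic (local_divisor G c)"
  unfolding aperiodic_def
proof
  let ?L = "local_divisor G c"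
  interpret L: monoid ?L by (rule monoid_local_divisor[OF c])
  fix x assume x: "x \<in> carrier ?L"
  then obtain y where y: "y \<in> carrier G" "x = c \<otimes> y" by (rule local_divisor_carrierE)
  have pow: "x [^]\<^bsub>?L\<^esub> n = c \<otimes> y [^] n" for n :: nat
  proof (induction n)
    case 0
    then show ?case using c by (simp add: one_local_divisor)
  next
    case (Suc n)
    have "x [^]\<^bsub>?L\<^esub> Suc n = x [^]\<^bsub>?L\<^esub> n \<otimes> y"
      using mult_local_divisor[OF c L.nat_pow_closed[OF x] y(1)] y(2) by simp
    then show ?case using Suc.IH c y(1) by (simp add: m_assoc)
  qed
  show "\<exists>n::nat. x [^]\<^bsub>?L\<^esub> Suc n = x [^]\<^bsub>?L\<^esub> n"
  proof -
    obtain n :: nat where "y [^] Suc n = y [^] n" using G y(1) unfolding aperiodic_def by blast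
    then show ?thesis unfolding pow by (intro exI[of _ n]) simp
  qed
qed

text \<open>If \<open>\<one> = c \<otimes> a\<close> then \<open>\<one> = c [^] n \<otimes> a [^] n\<close> for all \<open>n\<close>, and \<open>c [^] n\<close> absorbs a further
  factor \<open>c\<close> for large \<open>n\<close>.\<close>

lemma card_local_divisor:
  assumes c: "c \<in> carrier G" "c \<noteq> \<one>" and G: "aperiodic G" "finite (carrier G)"
  shows "card (carrier (local_divisor G c)) < card (carrier G)"
proof -
  \<comment> \<open>The unit of \<open>G\<close> is the element that is lost, making the inclusion
    of carriers proper.\<close>
  have "\<one> \<notin> carrier (local_divisor G c)"
  proof
    assume "\<one> \<in> carrier (local_divisor G c)"
    then obtain a where a: "a \<in> carrier G" "\<one> = c \<otimes> a" by (rule local_divisor_carrierE)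
    have one: "c [^] n \<otimes> a [^] n = \<one>" for n :: nat
    proof (induction n)
      case (Suc n)
      have "c [^] Suc n \<otimes> a [^] Suc n = c [^] n \<otimes> (c \<otimes> a) \<otimes> a [^] n"
        unfolding nat_pow_Suc2[OF a(1)] using a(1) c(1) by (simp add: m_assoc)
      then show ?case using Suc.IH a(1) c(1) by (simp flip: a(2))
    qed simp
    obtain n :: nat where "c [^] Suc n = c [^] n" using G(1) c(1) unfolding aperiodic_def by blast
    then have "c \<otimes> c [^] n = c [^] n" unfolding nat_pow_Suc2[OF c(1)] .
    then have "c \<otimes> (c [^] n \<otimes> a [^] n) = c [^] n \<otimes> a [^] n"
      using a(1) c(1) by (simp flip: m_assoc)
    with one c show False by simp
  qed
  then have "carrier (local_divisor G c) \<subset> carrier G"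
    using local_divisor_subset[OF c(1)] one_closed by blast
  then show ?thesis by (rule psubset_card_mono[OF G(2)])
qed

end

section \<open>Products of labels\<close>

text \<open>The segment starts strictly after \<open>i\<close>, like the strict until, and stops
  before the first position satisfying \<open>E\<close> or at the end of the word.\<close>

definition segment_product ::
  "('m, 'b) monoid_scheme \<Rightarrow> ('a list \<Rightarrow> nat \<Rightarrow> bool) \<Rightarrow> ('a list \<Rightarrow> nat \<Rightarrow> 'm) \<Rightarrow> 'a list \<Rightarrow> nat \<Rightarrow> 'm" where
  "segment_product G E f w i =
     foldr (\<lambda>j x. f w j \<otimes>\<^bsub>G\<^esub> x) (takeWhile (\<lambda>j. \<not> E w j) [Suc i..<Suc (length w)]) \<one>\<^bsub>G\<^esub>"

lemma segment_product_unfold: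
  "segment_product G E f w i =
     (if i < length w \<and> \<not> E w (Suc i) then f w (Suc i) \<otimes>\<^bsub>G\<^esub> segment_product G E f w (Suc i) else \<one>\<^bsub>G\<^esub>)"
proof (cases "i < length w")
  case True
  then show ?thesis unfolding segment_product_def by (subst upt_conv_Cons) (simp_all del: upt_Suc)
next
  case False
  then show ?thesis unfolding segment_product_def by simp
qed

lemma (in monoid) segment_product_closed:
  "(\<And>j. f w j \<in> carrier G) \<Longrightarrow> segment_product G E f w i \<in> carrier G"
proof (induction "length w - i" arbitrary: i)
  case 0
  then show ?case by (subst segment_product_unfold) simp
next
  case (Suc n)
  then show ?case by (subst segment_product_unfold) simp
qed

lemma (in monoid) segment_product_one:
  "(\<And>j. f w j = \<one>) \<Longrightarrow> segment_product G E f w i = \<one>"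
proof (induction "length w - i" arbitrary: i)
  case 0
  then show ?case by (subst segment_product_unfold) simp
next
  case (Suc n)
  then show ?case by (subst segment_product_unfold) simp
qed

text \<open>Cutting a segment at its positions labelled \<open>c\<close> writes its product as the first block,
  times a product in the local divisor whose factors are the inner blocks enclosed in \<open>c\<close>,
  times the last block.\<close>

locale segment_blocks = monoid G for G :: "'m monoid" (structure) +
  fixes c :: 'm and E :: "'a list \<Rightarrow> nat \<Rightarrow> bool" and f :: "'a list \<Rightarrow> nat \<Rightarrow> 'm"
  assumes c: "c \<in> carrier G"
    and f: "\<And>w j. f w j \<in> carrier G"
begin

definition cut where "cut w j \<longleftrightarrow> f w j = c \<and> \<not> E w j"
definition cut_ahead where "cut_ahead = until (\<lambda>w j. \<not> E w j) cut"
text \<open>Positions labelled \<open>c\<close> end a block. Relabelling them by the unit removes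
  \<open>c\<close> from the set of labels when \<open>c\<close> is not the unit, which makes room
  for induction on that set.\<close>

definition block where
  "block = segment_product G (\<lambda>w j. E w j \<or> f w j = c) (\<lambda>w j. if f w j = c then \<one> else f w j)"
text \<open>The last cut of the segment is the one with no cut ahead. Taking the value
  \<open>t\<close> of its block as a parameter turns the condition into a single until.\<close>

definition last_block where
  "last_block t = until (\<lambda>w j. \<not> E w j) (\<lambda>w j. cut w j \<and> \<not> cut_ahead w j \<and> block w j = t)"
text \<open>All positions except cuts followed by another cut get \<open>c\<close>, the unit of the
  local divisor, and so contribute nothing. The last cut is among them, its block being left to
  \<open>last_block\<close>.\<close>

definition inner where
  "inner w j = (if f w j = c \<and> cut_ahead w j then c \<otimes> block w j \<otimes> c else c)"
abbreviation inner_product where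
  "inner_product \<equiv> segment_product (local_divisor G c) E inner"

lemma block_closed: "block w i \<in> carrier G"
  unfolding block_def by (rule segment_product_closed) (simp add: f)

lemma inner_closed: "inner w j \<in> carrier (local_divisor G c)"
  unfolding inner_def using sandwich_in_local_divisor[OF c block_closed] self_in_local_divisor[OF c] by simp

lemma inner_product_closed: "inner_product w i \<in> carrier (local_divisor G c)"
  by (rule monoid.segment_product_closed[OF monoid_local_divisor[OF c] inner_closed])

lemma block_unfold:
  "block w i = (if i < length w \<and> \<not> E w (Suc i) \<and> f w (Suc i) \<noteq> c
    then f w (Suc i) \<otimes> block w (Suc i) else \<one>)"
  unfolding block_def by (subst segment_product_unfold) simp

lemma cut_ahead_unfold:
  "cut_ahead w i \<longleftrightarrow> i < length w \<and> \<not> E w (Suc i) \<and> (f w (Suc i) = c \<or> cut_ahead w (Suc i))"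
  unfolding cut_ahead_def by (subst until_unfold) (auto simp: cut_def)

lemma last_block_unfold:
  "last_block t w i \<longleftrightarrow> i < length w \<and> \<not> E w (Suc i) \<and>
    (f w (Suc i) = c \<and> \<not> cut_ahead w (Suc i) \<and> block w (Suc i) = t \<or> last_block t w (Suc i))"
  unfolding last_block_def by (subst until_unfold) (auto simp: cut_def)

lemma last_block_imp_cut_ahead: "last_block t w i \<Longrightarrow> cut_ahead w i"
  unfolding last_block_def cut_ahead_def until_def by blast

lemma last_block_exists: "cut_ahead w i \<Longrightarrow> \<exists>t\<in>carrier G. last_block t w i"
proof (induction "length w - i" arbitrary: i)
  case 0
  then show ?case by (subst (asm) cut_ahead_unfold) simp
next
  case (Suc n)
  show ?case
  proof (cases "cut_ahead w (Suc i)")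
    case True
    moreover have "n = length w - Suc i" using Suc.hyps(2) by simp
    ultimately obtain t where "t \<in> carrier G" "last_block t w (Suc i)" using Suc.hyps(1) by blast
    then show ?thesis using Suc.prems cut_ahead_unfold[of w i] last_block_unfold[of _ w i] by blast
  next
    case False
    then show ?thesis
      using Suc.prems cut_ahead_unfold[of w i] last_block_unfold[of _ w i] block_closed by blast
  qed
qed

lemma inner_product_no_cut: "\<not> cut_ahead w i \<Longrightarrow> inner_product w i = c"
proof (induction "length w - i" arbitrary: i)
  case 0
  then show ?case by (subst segment_product_unfold) (simp add: one_local_divisor)
next
  case (Suc n)
  interpret L: monoid "local_divisor G c" by (rule monoid_local_divisor[OF c])
  show ?case
  proof (cases "E w (Suc i)")
    case True
    then show ?thesis by (subst segment_product_unfold) (simp add: one_local_divisor)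
  next
    case False
    then have nc: "\<not> cut_ahead w (Suc i)" "f w (Suc i) \<noteq> c"
      using Suc.prems Suc.hyps(2) cut_ahead_unfold[of w i] by auto
    moreover have "n = length w - Suc i" using Suc.hyps(2) by simp
    ultimately have "inner_product w (Suc i) = c" using Suc.hyps(1) by blast
    then show ?thesis
      using nc L.l_one[OF L.one_closed]
      by (subst segment_product_unfold) (simp add: inner_def one_local_divisor)
  qed
qed

lemma segment_product_no_cut: "\<not> cut_ahead w i \<Longrightarrow> segment_product G E f w i = block w i"
proof (induction "length w - i" arbitrary: i)
  case 0
  then show ?case by (subst segment_product_unfold, subst block_unfold) simp
next
  case (Suc n)
  show ?case
  proof (cases "E w (Suc i)")
    case True
    then show ?thesis by (subst segment_product_unfold, subst block_unfold) simp
  next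
    case False
    then have nc: "\<not> cut_ahead w (Suc i)" "f w (Suc i) \<noteq> c"
      using Suc.prems Suc.hyps(2) cut_ahead_unfold[of w i] by auto
    moreover have "n = length w - Suc i" using Suc.hyps(2) by simp
    ultimately have "segment_product G E f w (Suc i) = block w (Suc i)" using Suc.hyps(1) by blast
    then show ?thesis using nc by (subst segment_product_unfold, subst block_unfold) simp
  qed
qed

text \<open>Induction from the end of the word, where the next position is the last cut, an earlier
  cut or no cut. The inner product begins and ends with \<open>c\<close> and so supplies the cut
  labels missing from the first and last block; with a single cut it is just
  \<open>c\<close>.\<close>

lemma segment_product_blocks:
  "last_block t w i \<Longrightarrow> segment_product G E f w i = block w i \<otimes> inner_product w i \<otimes> t"
proof (induction "length w - i" arbitrary: i)
  case 0
  then show ?case by (subst (asm) last_block_unfold) simp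
next
  case (Suc n)
  interpret L: monoid "local_divisor G c" by (rule monoid_local_divisor[OF c])
  let ?i = "Suc i"
  have n: "n = length w - ?i" using Suc.hyps(2) by simp
  have iw: "i < length w" "\<not> E w ?i" using Suc.prems last_block_unfold[of t w i] by auto
  have seg: "segment_product G E f w i = f w ?i \<otimes> segment_product G E f w ?i"
    using iw by (subst segment_product_unfold) simp
  have inn: "inner_product w i = inner w ?i \<otimes>\<^bsub>local_divisor G c\<^esub> inner_product w ?i"
    using iw by (subst segment_product_unfold) simp
  note b = block_closed[of w ?i]
  have P: "inner_product w ?i \<in> carrier G"
    using inner_product_closed local_divisor_subset[OF c] by blast
  show ?case
  proof (cases "last_block t w ?i")
    case True
    then have IH: "segment_product G E f w ?i = block w ?i \<otimes> inner_product w ?i \<otimes> t"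
      using Suc.hyps(1) n by blast
    have ca: "cut_ahead w ?i" using True by (rule last_block_imp_cut_ahead)
    have t: "t \<in> carrier G"
      using True block_closed unfolding last_block_def until_def by blast
    show ?thesis
    proof (cases "f w ?i = c")
      case c': True
      \<comment> \<open>Multiplying \<open>c \<otimes> block w ?i \<otimes> c\<close> by
        \<open>c \<otimes> y\<close> in the local divisor merges the adjacent two occurrences of
        \<open>c\<close>, so the cut is counted once.\<close>
      obtain y where y: "y \<in> carrier G" "inner_product w ?i = c \<otimes> y"
        using inner_product_closed by (rule local_divisor_carrierE)
      have "inner_product w i = c \<otimes> block w ?i \<otimes> c \<otimes> y"
        unfolding inn y(2) using mult_local_divisor[OF c inner_closed[of w ?i] y(1)] c' ca
        by (simp add: inner_def)
      then have "inner_product w i = c \<otimes> block w ?i \<otimes> inner_product w ?i"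
        using y b c by (simp add: m_assoc)
      moreover have "block w i = \<one>" using c' by (subst block_unfold) simp
      ultimately show ?thesis using seg IH c' b P c t by (simp add: m_assoc)
    next
      case False
      then have "inner_product w i = inner_product w ?i"
        unfolding inn using L.l_one[OF inner_product_closed] by (simp add: inner_def one_local_divisor)
      moreover have "block w i = f w ?i \<otimes> block w ?i"
        using False iw by (subst block_unfold) simp
      ultimately show ?thesis using seg IH b P f t by (simp add: m_assoc)
    qed
  next
    case False
    then have *: "f w ?i = c" "\<not> cut_ahead w ?i" "block w ?i = t"
      using Suc.prems last_block_unfold[of t w i] by auto
    have "block w i = \<one>" using *(1) by (subst block_unfold) simp
    moreover have "inner_product w i = c"
      unfolding inn inner_product_no_cut[OF *(2)] using * L.l_one[OF L.one_closed]
      by (simp add: inner_def one_local_divisor)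
    ultimately show ?thesis
      using seg segment_product_no_cut[OF *(2)] * b c by simp
  qed
qed

text \<open>The value is reduced to finitely many guesses: the outer blocks involve fewer labels and
  the inner product lives in the local divisor.\<close>

lemma segment_product_eq_iff:
  "segment_product G E f w i = m \<longleftrightarrow>
     \<not> cut_ahead w i \<and> block w i = m \<or>
     (\<exists>s\<in>carrier G. \<exists>p\<in>carrier (local_divisor G c). \<exists>t\<in>carrier G.
        s \<otimes> p \<otimes> t = m \<and> block w i = s \<and> inner_product w i = p \<and> last_block t w i)"
proof (cases "cut_ahead w i")
  case True
  show ?thesis
  proof
    assume m: "segment_product G E f w i = m"
    obtain t where t: "t \<in> carrier G" "last_block t w i"
      using last_block_exists[OF True] by blast
    with m have "block w i \<otimes> inner_product w i \<otimes> t = m"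
      using segment_product_blocks by simp
    then show "\<not> cut_ahead w i \<and> block w i = m \<or>
     (\<exists>s\<in>carrier G. \<exists>p\<in>carrier (local_divisor G c). \<exists>t\<in>carrier G.
        s \<otimes> p \<otimes> t = m \<and> block w i = s \<and> inner_product w i = p \<and> last_block t w i)"
      using t
      by (intro disjI2 bexI[OF _ block_closed[of w i]] bexI[OF _ inner_product_closed[of w i]]
          bexI[OF _ t(1)]) simp
  next
    assume "\<not> cut_ahead w i \<and> block w i = m \<or>
     (\<exists>s\<in>carrier G. \<exists>p\<in>carrier (local_divisor G c). \<exists>t\<in>carrier G.
        s \<otimes> p \<otimes> t = m \<and> block w i = s \<and> inner_product w i = p \<and> last_block t w i)"
    then obtain s p t where "s \<otimes> p \<otimes> t = m" "block w i = s" "inner_product w i = p" "last_block t w i"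
      using True by blast
    then show "segment_product G E f w i = m" using segment_product_blocks by simp
  qed
next
  case False
  then show ?thesis
    using segment_product_no_cut[OF False] last_block_imp_cut_ahead[of _ w i] by auto
qed

text \<open>The assumptions \<open>block\<close> and \<open>inner\<close> are the two inductive
  calls. The second is an implication because its labelling has to be shown expressible first, which
  is done here from \<open>block\<close> and \<open>cut_ahead\<close>.\<close>

lemma ltl_expressible_segment_product_blocks:
  assumes fin: "finite (carrier G)"
    and E: "ltl_expressible E" and fe: "\<And>x. ltl_expressible (\<lambda>w j. f w j = x)"
    and block: "\<And>x. ltl_expressible (\<lambda>w j. block w j = x)"
    and inner: "(\<And>x. ltl_expressible (\<lambda>w j. inner w j = x)) \<Longrightarrow>
      (\<And>x. ltl_expressible (\<lambda>w j. inner_product w j = x))"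
  shows "ltl_expressible (\<lambda>w j. segment_product G E f w j = m)"
proof -
  have cut: "ltl_expressible cut"
    unfolding cut_def[abs_def] by (intro ltl_expressible_intros fe E)
  have ca: "ltl_expressible cut_ahead"
    unfolding cut_ahead_def by (intro ltl_expressible_intros E cut)
  have lb: "ltl_expressible (last_block t)" for t
    unfolding last_block_def by (intro ltl_expressible_intros E cut ca block)
  have fin': "finite (carrier (local_divisor G c))"
    using local_divisor_subset[OF c] fin finite_subset by blast
  have "ltl_expressible (\<lambda>w j. inner w j = x)" for x
  proof -
    have "ltl_expressible (\<lambda>w j. (\<exists>t\<in>carrier G. (f w j = c \<and> cut_ahead w j) \<and> block w j = t \<and> c \<otimes> t \<otimes> c = x) \<or>
        \<not> (f w j = c \<and> cut_ahead w j) \<and> c = x)"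
      by (intro ltl_expressible_intros fin fe ca block)
    then show ?thesis
      by (rule ltl_expressible_cong) (use block_closed in \<open>auto simp: inner_def\<close>)
  qed
  note ip = inner[OF this]
  have "ltl_expressible (\<lambda>w i. \<not> cut_ahead w i \<and> block w i = m \<or>
     (\<exists>s\<in>carrier G. \<exists>p\<in>carrier (local_divisor G c). \<exists>t\<in>carrier G.
        s \<otimes> p \<otimes> t = m \<and> block w i = s \<and> inner_product w i = p \<and> last_block t w i))"
    by (intro ltl_expressible_intros fin fin' ca block lb ip)
  then show ?thesis by (simp only: segment_product_eq_iff)
qed

end

text \<open>Nested induction, outside on the size of the monoid and inside on a set \<open>A\<close>
  containing all labels other than the unit. Blocks have labels in a smaller set, inner products lie
  in a smaller monoid. Both inductions leave \<open>E\<close> and \<open>f\<close> arbitrary, as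
  blocks have new ends and new labels.\<close>

theorem ltl_expressible_segment_product:
  fixes G :: "'m monoid" and E :: "'a list \<Rightarrow> nat \<Rightarrow> bool"
  assumes "monoid G" "finite (carrier G)" "aperiodic G"
    and "ltl_expressible E" "\<And>x. ltl_expressible (\<lambda>w j. f w j = x)" "\<And>w j. f w j \<in> carrier G"
  shows "ltl_expressible (\<lambda>w j. segment_product G E f w j = m)"
  using assms
proof (induction "card (carrier G)" arbitrary: G E f m rule: less_induct)
  case less
  interpret monoid G by (rule less.prems(1))
  have "ltl_expressible (\<lambda>w j. segment_product G E f w j = m)"
    if "finite A" "A \<subseteq> carrier G" "ltl_expressible E" "\<And>x. ltl_expressible (\<lambda>w j. f w j = x)"
      "\<And>w j. f w j \<in> insert \<one>\<^bsub>G\<^esub> A" for A and E :: "'a list \<Rightarrow> nat \<Rightarrow> bool" and f m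
    using that
  proof (induction A arbitrary: E f m rule: finite_induct)
    case empty
    then have "segment_product G E f w j = \<one>\<^bsub>G\<^esub>" for w j by (intro segment_product_one) simp
    then show ?case using ltl_expressible_const by simp
  next
    case (insert c A)
    show ?case
    proof (cases "c = \<one>\<^bsub>G\<^esub>")
      case True
      then show ?thesis using insert.prems by (intro insert.IH) simp_all
    next
      case False
      have c: "c \<in> carrier G" using insert.prems(1) by simp
      have f: "f w j \<in> carrier G" for w j
        using insert.prems(1) insert.prems(4)[of w j] by auto
      interpret segment_blocks G c E f
        by unfold_locales (rule c, rule f)
      show ?thesis
      proof (rule ltl_expressible_segment_product_blocks[OF less.prems(2) insert.prems(2,3)])
        fix x
        show "ltl_expressible (\<lambda>w j. block w j = x)"
          unfolding block_def
        proof (rule insert.IH)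
          show "A \<subseteq> carrier G" using insert.prems(1) by simp
          show "ltl_expressible (\<lambda>w j. E w j \<or> f w j = c)"
            by (intro ltl_expressible_intros insert.prems)
          show "(if f w j = c then \<one>\<^bsub>G\<^esub> else f w j) \<in> insert \<one>\<^bsub>G\<^esub> A" for w j
            using insert.prems(4)[of w j] by auto
          show "ltl_expressible (\<lambda>w j. (if f w j = c then \<one>\<^bsub>G\<^esub> else f w j) = y)" for y
          proof -
            have "ltl_expressible (\<lambda>w j. f w j = c \<and> \<one>\<^bsub>G\<^esub> = y \<or> \<not> f w j = c \<and> f w j = y)"
              by (intro ltl_expressible_intros insert.prems)
            then show ?thesis by (rule ltl_expressible_cong) auto
          qed
        qed
        assume "\<And>x. ltl_expressible (\<lambda>w j. inner w j = x)"
        then show "ltl_expressible (\<lambda>w j. inner_product w j = x)"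
          using less.prems(2,3) insert.prems(2) False c finite_subset[OF local_divisor_subset[OF c]]
          by (intro less.hyps card_local_divisor monoid_local_divisor aperiodic_local_divisor inner_closed) auto
      qed
    qed
  qed
  from this[of "carrier G" E f m] less.prems(2,4-) show ?case by simp
qed

section \<open>From first-order logic to temporal logic\<close>

definition ef_rep :: "nat \<Rightarrow> 'a list \<Rightarrow> 'a list" where
  "ef_rep k u = (SOME v. v \<in> ef_class k u)"

lemma ef_equiv_rep: "ef_equiv k u (ef_rep k u)"
proof -
  have "u \<in> ef_class k u" by (simp add: ef_class_def ef_equiv_refl)
  then have "ef_rep k u \<in> ef_class k u" unfolding ef_rep_def by (rule someI)
  then show ?thesis by (simp add: ef_class_def)
qed

lemma ef_rep_eq_iff: "ef_rep k u = ef_rep k v \<longleftrightarrow> ef_equiv k u v"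
proof
  assume "ef_rep k u = ef_rep k v"
  then show "ef_equiv k u v" using ef_equiv_rep ef_equiv_sym ef_equiv_trans by metis
next
  assume "ef_equiv k u v"
  then have "ef_class k u = ef_class k v" by (simp only: ef_class_eq_iff)
  then show "ef_rep k u = ef_rep k v" unfolding ef_rep_def by simp
qed

lemma ef_rep_append: "ef_rep k (ef_rep k u @ ef_rep k v) = ef_rep k (u @ v)"
  unfolding ef_rep_eq_iff by (intro ef_equiv_append ef_equiv_sym[OF ef_equiv_rep])

text \<open>This is the quotient of the free monoid by \<open>ef_equiv k\<close>, with each class
  replaced by a word chosen from it. The choice depends on the class alone, so equality of elements
  is equivalence of words.\<close>

definition ef_monoid :: "nat \<Rightarrow> 'a list monoid" where
  "ef_monoid k = \<lparr>carrier = range (ef_rep k), mult = (\<lambda>u v. ef_rep k (u @ v)), one = ef_rep k []\<rparr>"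

lemma carrier_ef_monoid: "carrier (ef_monoid k) = range (ef_rep k)"
  by (simp add: ef_monoid_def)

lemma mult_ef_monoid: "ef_rep k u \<otimes>\<^bsub>ef_monoid k\<^esub> ef_rep k v = ef_rep k (u @ v)"
  by (simp add: ef_monoid_def ef_rep_append)

lemma one_ef_monoid: "\<one>\<^bsub>ef_monoid k\<^esub> = ef_rep k []"
  by (simp add: ef_monoid_def)

lemma monoid_ef_monoid: "monoid (ef_monoid k)"
  by unfold_locales (auto simp: carrier_ef_monoid mult_ef_monoid one_ef_monoid)

lemma finite_ef_monoid: "finite (carrier (ef_monoid k :: 'a::finite list monoid))"
proof -
  have "range (ef_rep k :: 'a list \<Rightarrow> _) = (\<lambda>C. SOME v. v \<in> C) ` range (ef_class k)"
    by (simp add: ef_rep_def image_image)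
  then show ?thesis
    unfolding carrier_ef_monoid by (simp only:) (intro finite_imageI finite_ef_classes)
qed

text \<open>The powers of the element of \<open>u\<close> are those of the repeated words, for which
  \<open>ef_equiv_replicate_Suc\<close> applies with exponent \<open>2 ^ k\<close>.\<close>

lemma aperiodic_ef_monoid: "aperiodic (ef_monoid k)"
  unfolding aperiodic_def
proof
  interpret monoid "ef_monoid k" by (rule monoid_ef_monoid)
  fix x :: "'a list" assume "x \<in> carrier (ef_monoid k)"
  then obtain u where u: "x = ef_rep k u" unfolding carrier_ef_monoid by blast
  have pow: "x [^]\<^bsub>ef_monoid k\<^esub> n = ef_rep k (concat (replicate n u))" for n :: nat
  proof (induction n)
    case 0
    then show ?case by (simp add: one_ef_monoid)
  next
    case (Suc n)
    then have "x [^]\<^bsub>ef_monoid k\<^esub> Suc n = ef_rep k (concat (replicate n u) @ u)"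
      by (simp add: u mult_ef_monoid)
    also have "concat (replicate n u) @ u = concat (replicate n u @ [u])" by simp
    also have "replicate n u @ [u] = replicate (Suc n) u" by (simp add: replicate_append_same)
    finally show ?case .
  qed
  have "ef_equiv k (concat (replicate (2 ^ k) u)) (concat (replicate (Suc (2 ^ k)) u))"
    by (rule ef_equiv_replicate_Suc) simp
  then show "\<exists>n::nat. x [^]\<^bsub>ef_monoid k\<^esub> Suc n = x [^]\<^bsub>ef_monoid k\<^esub> n"
    unfolding pow ef_rep_eq_iff using ef_equiv_sym by blast
qed

text \<open>With no position marked as an end, the segment after \<open>i\<close> runs to the end of
  the word; in 0-based terms this is \<open>drop i w\<close>.\<close>

lemma segment_product_ef_monoid:
  "segment_product (ef_monoid k) (\<lambda>w i. False) (\<lambda>w j. ef_rep k [letter_at w j]) w i = ef_rep k (drop i w)"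
proof (induction "length w - i" arbitrary: i)
  case 0
  then show ?case by (subst segment_product_unfold) (simp add: one_ef_monoid)
next
  case (Suc n)
  then have i: "i < length w" "n = length w - Suc i" by simp_all
  from Suc.hyps(1)[OF i(2)] i(1) show ?case
    by (subst segment_product_unfold)
       (simp add: mult_ef_monoid letter_at_def Cons_nth_drop_Suc)
qed

text \<open>Truth of \<open>\<theta>\<close> depends only on the class of the word, and that class
  is the product of the classes of its letters. The formula tests whether this product lies in the
  set \<open>S\<close> of representatives of the words satisfying \<open>\<theta>\<close>.\<close>

lemma fo_lang_in_ltl_definable:
  fixes \<theta> :: "'a::finite fo"
  assumes "fo_sentence \<theta>"
  shows "fo_lang \<theta> \<in> ltl_definable"
proof -
  define k where "k = fo_rank \<theta> + 2"
  have cong: "fo_sat u v \<theta> \<longleftrightarrow> fo_sat w v \<theta>" if "ef_rep k u = ef_rep k w" for u w v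
    using fo_sentence_cong_ef_equiv[OF assms that[unfolded ef_rep_eq_iff k_def]] .
  define S where "S = {ef_rep k w | w. fo_sat w (\<lambda>_. 1) \<theta>}"
  define sp where "sp = segment_product (ef_monoid k) (\<lambda>w i. False)
    (\<lambda>w j. ef_rep k [letter_at w j] :: 'a list)"
  have sp: "sp w i = ef_rep k (drop i w)" for w i
    unfolding sp_def by (rule segment_product_ef_monoid)
  have letter: "ltl_expressible (\<lambda>w j. ef_rep k [letter_at w j] = (x :: 'a list))" for x
  proof -
    have "ltl_expressible (\<lambda>w j. \<exists>a\<in>(UNIV :: 'a set). letter_at w j = a \<and> ef_rep k [a] = x)"
      by (intro ltl_expressible_intros ltl_expressible_letter finite)
    then show ?thesis by simp
  qed
  have "ltl_expressible (\<lambda>w i. sp w i = m)" for m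
    unfolding sp_def
    by (intro ltl_expressible_segment_product monoid_ef_monoid finite_ef_monoid aperiodic_ef_monoid
        ltl_expressible_const letter) (simp add: carrier_ef_monoid)
  \<comment> \<open>The segment product leaves out the current position, so its letter
    \<open>a\<close> is guessed separately and put in front.\<close>
  then have "ltl_expressible (\<lambda>w i. \<exists>a\<in>(UNIV :: 'a set). \<exists>m\<in>carrier (ef_monoid k).
      letter_at w i = a \<and> sp w i = m \<and> ef_rep k ([a] @ m) \<in> S)"
    by (intro ltl_expressible_intros ltl_expressible_letter finite finite_ef_monoid)
  then obtain \<phi> :: "'a ltl" where \<phi>: "\<And>w i. i \<in> dom_word w \<Longrightarrow> ltl_sat w i \<phi> \<longleftrightarrow>
      (\<exists>a\<in>UNIV. \<exists>m\<in>carrier (ef_monoid k). letter_at w i = a \<and> sp w i = m \<and> ef_rep k ([a] @ m) \<in> S)"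
    unfolding ltl_expressible_def by blast
  have "ltl_sat w 1 \<phi> \<longleftrightarrow> fo_sat w (\<lambda>_. 1) \<theta>" if w: "w \<noteq> []" for w
  proof -
    obtain a u where au: "w = a # u" using w by (cases w) auto
    have "ltl_sat w 1 \<phi> \<longleftrightarrow> ef_rep k ([a] @ ef_rep k u) \<in> S"
      unfolding \<phi>[OF one_in_dom_word[OF w]] sp by (simp add: carrier_ef_monoid au letter_at_def)
    also have "ef_rep k ([a] @ ef_rep k u) = ef_rep k w"
      unfolding ef_rep_eq_iff using ef_equiv_append[OF ef_equiv_refl ef_equiv_sym[OF ef_equiv_rep]]
      by (metis au append_Cons append_Nil)
    also have "ef_rep k w \<in> S \<longleftrightarrow> fo_sat w (\<lambda>_. 1) \<theta>"
      unfolding S_def using cong by blast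
    finally show ?thesis .
  qed
  then have "fo_lang \<theta> = ltl_lang \<phi>" unfolding fo_lang_def ltl_lang_def by blast
  then show ?thesis unfolding ltl_definable_def by blast
qed

theorem lemma8:
  shows "(\<forall>(k::nat) (\<phi>::'a::finite ltl). ltl_depth \<phi> \<le> k \<longrightarrow>
            (\<exists>\<psi>::'a atn. atn_rd \<psi> \<le> k \<and> atn_lang \<psi> = ltl_lang \<phi>))
       \<and> (atn_definable :: 'a list set set) = ltl_definable
       \<and> (ltl_definable :: 'a list set set) = fo_definable"
proof (intro conjI allI impI)
  fix k and \<phi> :: "'a ltl" assume "ltl_depth \<phi> \<le> k"
  then show "\<exists>\<psi>. atn_rd \<psi> \<le> k \<and> atn_lang \<psi> = ltl_lang \<phi>"
    using atn_rd_ltl_to_atn atn_lang_ltl_to_atn by metis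
next
  show "(atn_definable :: 'a list set set) = ltl_definable"
    unfolding atn_definable_def ltl_definable_def
    using atn_lang_ltl_to_atn ltl_lang_atn_to_ltl by blast
next
  have "fo_definable \<subseteq> (ltl_definable :: 'a list set set)"
    using fo_lang_in_ltl_definable unfolding fo_definable_def by blast
  moreover have "ltl_definable \<subseteq> (fo_definable :: 'a list set set)"
    using ltl_lang_in_fo_definable unfolding ltl_definable_def by blast
  ultimately show "(ltl_definable :: 'a list set set) = fo_definable" by blast
qed

end
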